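(* Let $f:X\to X$ be the one-sided full shift on $\{0,1,2,3\}$, let $\Phi:X\to\mathbb{R}^2$ be the potential and $(\Phi_{\epsilon_n})_n$, $\epsilon_n=2^{-n}$, the approximating potentials defined explicitly in the context, and let $w(\infty)=(0,0)$. Then $$0=\lim_{n\to\infty}h^l_{\Phi_{\epsilon_n}}(w(\infty),\epsilon_n)<\lim_{n\to\infty}h^u_{\Phi_{\epsilon_n}}(w(\infty),\epsilon_n)=\log2 .$$
   Context: General notation. $X=\{0,1,2,3\}^{\mathbb{N}}$ with the product topology, $f(\xi)_k=\xi_{k+1}$; $\mathcal{M}$ is the set of $f$-invariant Borel probability measures; $h_\mu(f)$ is the measure-theoretic entropy. For bounded Borel $\Psi:X\to\mathbb{R}^2$: $\mathrm{rv}_\Psi(\mu)=\int\Psi\,d\mu$ (componentwise), $\mathrm{Rot}(\Psi)=\{\mathrm{rv}_\Psi(\mu):\mu\in\mathcal{M}\}$, $\mathcal{H}_\Psi(w)=\sup\{h_\mu(f):\mu\in\mathcal{M},\,\mathrm{rv}_\Psi(\mu)=w\}$ for $w\in\mathrm{Rot}(\Psi)$, and $h^u_\Psi(w_0,r)$, $h^l_\Psi(w_0,r)$ are respectively the supremum and the infimum of $\mathcal{H}_\Psi(w)$ over $w\in\overline{B}(w_0,r)\cap\mathrm{Rot}(\Psi)$ (with $\sup\emptyset=+\infty$, $\inf\emptyset=-\infty$). For $z\in X$, $\mathcal{C}_k(z)=\{\xi\in X:\xi_1=z_1,\dots,\xi_k=z_k\}$. Data. Fix $a>0$ and $\ell_1:[0,a]\to\mathbb{R}$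 continuous, non-negative, increasing, strictly concave, with $\ell_1(0)=0$; put $\ell_2=-\ell_1$. Fix a sequence $(x_k)_{k\in\mathbb{N}}$ in $(0,a)$, strictly decreasing to $0$ exponentially fast. Fix an integer $\lambda\ge3$. Assume $\sum_{k=1}^\infty x_k<a$ and $\ell_1(x_1)<(\lambda+1)\ell_1(x_2)$. Let $x=(1,1,1,\dots)$ and $y=(3,3,3,\dots)$ in $X$ (the point $x$ is not to be confused with the numbers $x_k$), $S_1=\{0,1\}$, $S_2=\{2,3\}$. For $i=1,2$: $\widetilde Y_i(k)=\{\xi:\xi_1,\dots,\xi_k\in S_i\}$, $Y_i(\infty)=\bigcap_k\widetilde Y_i(k)$, $Y_i(k)=\widetilde Y_i(k-1)\setminus\widetilde Y_i(k)$. For $k>\lambda$: $X_1(k)=Y_1(k)\setminus\mathcal{C}_{k-1}(x)$, $X_2(k)=Y_2(k)\setminus\mathcal{C}_{k-1}(y)$, $X(k)=X_1(k)\cup X_2(k)$. Also $Y_0(\lambda)=X\setminus(\widetilde Y_1(\lambda)\cup\widetilde Y_2(\lambda))$. Potential $\Phi$: $\Phi(\xi)=(a,0)$ if $\xi\in Y_0(\lambda)$; $\Phi(\xi)=(x_{k-\lambda},0)$ if $\xi\in X(k)$, $k>\lambda$; $\Phi(\xi)=(x_{k-\lambda},\ell_1(x_{k-\lambda}))$ if $\xi\in\mathcal{C}_{k-1}(x)\cap Y_1(k)$, $k>\lambda$; $\Phi(\xi)=(x_{k-\lambda},\ell_2(x_{k-\lambda}))$ if $\xi\in\mathcal{C}_{k-1}(y)\cap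 Y_2(k)$, $k>\lambda$; $\Phi(\xi)=(0,0)$ if $\xi\in Y_1(\infty)\cup Y_2(\infty)$. Approximations: for $n\in\mathbb{N}$ let $\epsilon_n=2^{-n}$ and fix $K=K(n)\ge2\lambda$ such that for all $k,l\ge K$, $\|(x_{k-\lambda},\ell_1(x_{k-\lambda}))\|<\epsilon_n$ and $\|(x_{k-\lambda},\ell_1(x_{k-\lambda}))-(x_{l-\lambda},\ell_1(x_{l-\lambda}))\|<\epsilon_n$. Let $X_{\epsilon_n}=\bigcup_{\lambda<k\le K}\big(X(k)\cup(\mathcal{C}_{k-1}(x)\cap Y_1(k))\cup(\mathcal{C}_{k-1}(y)\cap Y_2(k))\big)$. Then $\Phi_{\epsilon_n}(\xi)=\Phi(\xi)$ if $\xi\in X_{\epsilon_n}\cup Y_0(\lambda)$; $\Phi_{\epsilon_n}(\xi)=(x_{K+1-\lambda},0)$ if $\xi\in(\widetilde Y_1(K)\cup\widetilde Y_2(K))\setminus(\mathcal{C}_K(x)\cup\mathcal{C}_K(y))$; $\Phi_{\epsilon_n}(\xi)=(x_{K+1-\lambda},\ell_1(x_{K+1-\lambda}))$ if $\xi\in\mathcal{C}_K(x)$; $\Phi_{\epsilon_n}(\xi)=(x_{K+1-\lambda},\ell_2(x_{K+1-\lambda}))$ if $\xi\in\mathcal{C}_K(y)$. *)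

theory Defs
  imports "HOL-Probability.Probability"
begin

section \<open>Measure-theoretic entropy\<close>

definition fin_partition :: "'a measure \<Rightarrow> 'a set set \<Rightarrow> bool" where
  "fin_partition M \<alpha> \<longleftrightarrow> finite \<alpha> \<and> \<alpha> \<subseteq> sets M \<and> partition_on (space M) \<alpha>"

(* The summand of a null set vanishes because ln 0 = 0. *)
definition partition_entropy :: "'a measure \<Rightarrow> 'a set set \<Rightarrow> real" where
  "partition_entropy M \<alpha> = - (\<Sum>A\<in>\<alpha>. measure M A * ln (measure M A))"

(* The common refinement of the partitions T^{-i} \<alpha>, i < n. *)
definition iterated_join :: "'a measure \<Rightarrow> ('a \<Rightarrow> 'a) \<Rightarrow> 'a set set \<Rightarrow> nat \<Rightarrow> 'a set set" where
  "iterated_join M T \<alpha> n =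
     {space M \<inter> (\<Inter>i<n. (T ^^ i) -` A i) | A. \<forall>i<n. A i \<in> \<alpha>} - {{}}"

definition entropy_wrt :: "'a measure \<Rightarrow> ('a \<Rightarrow> 'a) \<Rightarrow> 'a set set \<Rightarrow> real" where
  "entropy_wrt M T \<alpha> = lim (\<lambda>n. partition_entropy M (iterated_join M T \<alpha> n) / real n)"

definition ks_entropy :: "'a measure \<Rightarrow> ('a \<Rightarrow> 'a) \<Rightarrow> ereal" where
  "ks_entropy M T = (SUP \<alpha>\<in>{\<alpha>. fin_partition M \<alpha>}. ereal (entropy_wrt M T \<alpha>))"

section \<open>The full shift on four symbols\<close>

(* The coordinate \<xi>_k, k \<ge> 1, is the value \<xi> (k - 1). *)
definition X :: "(nat \<Rightarrow> nat) set" where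
  "X = {\<xi>. \<forall>i. \<xi> i \<in> {0, 1, 2, 3}}"

definition shift :: "(nat \<Rightarrow> nat) \<Rightarrow> nat \<Rightarrow> nat" where
  "shift \<xi> = (\<lambda>i. \<xi> (Suc i))"

(* nat carries the discrete topology and nat \<Rightarrow> nat the product topology, so this is the
   Borel sigma-algebra of X. *)
definition borel_X :: "(nat \<Rightarrow> nat) measure" where
  "borel_X = restrict_space borel X"

definition invariant_measures :: "(nat \<Rightarrow> nat) measure set" where
  "invariant_measures =
     {\<mu>. prob_space \<mu> \<and> sets \<mu> = sets borel_X \<and> distr \<mu> \<mu> shift = \<mu>}"

definition rv :: "((nat \<Rightarrow> nat) \<Rightarrow> real \<times> real) \<Rightarrow> (nat \<Rightarrow> nat) measure \<Rightarrow> real \<times> real" where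
  "rv \<Psi> \<mu> = (\<integral>\<xi>. fst (\<Psi> \<xi>) \<partial>\<mu>, \<integral>\<xi>. snd (\<Psi> \<xi>) \<partial>\<mu>)"

definition Rot :: "((nat \<Rightarrow> nat) \<Rightarrow> real \<times> real) \<Rightarrow> (real \<times> real) set" where
  "Rot \<Psi> = rv \<Psi> ` invariant_measures"

(* Meaningful for w in Rot \<Psi> only. *)
definition loc_entropy :: "((nat \<Rightarrow> nat) \<Rightarrow> real \<times> real) \<Rightarrow> real \<times> real \<Rightarrow> ereal" where
  "loc_entropy \<Psi> w = (SUP \<mu>\<in>{\<mu>\<in>invariant_measures. rv \<Psi> \<mu> = w}. ks_entropy \<mu> shift)"

(* The convention for the empty set is the opposite of Sup {} = -\<infinity>, Inf {} = \<infinity> on ereal. *)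
definition h_upper :: "((nat \<Rightarrow> nat) \<Rightarrow> real \<times> real) \<Rightarrow> real \<times> real \<Rightarrow> real \<Rightarrow> ereal" where
  "h_upper \<Psi> w0 r =
     (if cball w0 r \<inter> Rot \<Psi> = {} then \<infinity>
      else (SUP w\<in>cball w0 r \<inter> Rot \<Psi>. loc_entropy \<Psi> w))"

definition h_lower :: "((nat \<Rightarrow> nat) \<Rightarrow> real \<times> real) \<Rightarrow> real \<times> real \<Rightarrow> real \<Rightarrow> ereal" where
  "h_lower \<Psi> w0 r =
     (if cball w0 r \<inter> Rot \<Psi> = {} then -\<infinity>
      else (INF w\<in>cball w0 r \<inter> Rot \<Psi>. loc_entropy \<Psi> w))"

section \<open>The potential and its approximations\<close>

definition cyl :: "nat \<Rightarrow> (nat \<Rightarrow> nat) \<Rightarrow> (nat \<Rightarrow> nat) set" where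
  "cyl k z = {\<xi>\<in>X. \<forall>i<k. \<xi> i = z i}"

definition ptx :: "nat \<Rightarrow> nat" where "ptx = (\<lambda>_. 1)"

definition pty :: "nat \<Rightarrow> nat" where "pty = (\<lambda>_. 3)"

definition S1 :: "nat set" where "S1 = {0, 1}"

definition S2 :: "nat set" where "S2 = {2, 3}"

definition Ytilde :: "nat set \<Rightarrow> nat \<Rightarrow> (nat \<Rightarrow> nat) set" where
  "Ytilde S k = {\<xi>\<in>X. \<forall>i<k. \<xi> i \<in> S}"

definition Yinf :: "nat set \<Rightarrow> (nat \<Rightarrow> nat) set" where
  "Yinf S = (\<Inter>k. Ytilde S k)"

definition Y :: "nat set \<Rightarrow> nat \<Rightarrow> (nat \<Rightarrow> nat) set" where
  "Y S k = Ytilde S (k - 1) - Ytilde S k"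

definition Xlev :: "nat \<Rightarrow> (nat \<Rightarrow> nat) set" where
  "Xlev k = (Y S1 k - cyl (k - 1) ptx) \<union> (Y S2 k - cyl (k - 1) pty)"

definition Y0 :: "nat \<Rightarrow> (nat \<Rightarrow> nat) set" where
  "Y0 lam = X - (Ytilde S1 lam \<union> Ytilde S2 lam)"

(* The index k > lam with \<xi> \<in> Y_1(k) \<union> Y_2(k); it exists and is unique for every point \<xi> of X
   outside Y0 lam, Yinf S1 and Yinf S2. *)
definition lev :: "nat \<Rightarrow> (nat \<Rightarrow> nat) \<Rightarrow> nat" where
  "lev lam \<xi> = (THE k. k > lam \<and> \<xi> \<in> Y S1 k \<union> Y S2 k)"

(* l1 is \ell_1, and \ell_2 = - \ell_1 is written out.  The defining clauses are Phi_clauses below. *)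
definition Phi ::
  "real \<Rightarrow> (real \<Rightarrow> real) \<Rightarrow> (nat \<Rightarrow> real) \<Rightarrow> nat \<Rightarrow> (nat \<Rightarrow> nat) \<Rightarrow> real \<times> real" where
  "Phi a l1 x lam \<xi> =
     (if \<xi> \<in> Y0 lam then (a, 0)
      else if \<exists>k>lam. \<xi> \<in> Xlev k then (x (lev lam \<xi> - lam), 0)
      else if \<exists>k>lam. \<xi> \<in> cyl (k - 1) ptx \<inter> Y S1 k
        then (x (lev lam \<xi> - lam), l1 (x (lev lam \<xi> - lam)))
      else if \<exists>k>lam. \<xi> \<in> cyl (k - 1) pty \<inter> Y S2 k
        then (x (lev lam \<xi> - lam), - l1 (x (lev lam \<xi> - lam)))
      else (0, 0))"

definition Xeps :: "nat \<Rightarrow> nat \<Rightarrow> (nat \<Rightarrow> nat) set" where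
  "Xeps lam K =
     (\<Union>k\<in>{lam<..K}. Xlev k \<union> (cyl (k - 1) ptx \<inter> Y S1 k) \<union> (cyl (k - 1) pty \<inter> Y S2 k))"

(* The approximation depends on n only through K = K(n).  The last clause is never reached on X;
   see Phi_eps_cover and Phi_eps_clauses. *)
definition Phi_eps ::
  "real \<Rightarrow> (real \<Rightarrow> real) \<Rightarrow> (nat \<Rightarrow> real) \<Rightarrow> nat \<Rightarrow> nat \<Rightarrow> (nat \<Rightarrow> nat) \<Rightarrow> real \<times> real" where
  "Phi_eps a l1 x lam K \<xi> =
     (if \<xi> \<in> Xeps lam K \<union> Y0 lam then Phi a l1 x lam \<xi>
      else if \<xi> \<in> (Ytilde S1 K \<union> Ytilde S2 K) - (cyl K ptx \<union> cyl K pty)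
        then (x (K + 1 - lam), 0)
      else if \<xi> \<in> cyl K ptx then (x (K + 1 - lam), l1 (x (K + 1 - lam)))
      else if \<xi> \<in> cyl K pty then (x (K + 1 - lam), - l1 (x (K + 1 - lam)))
      else (0, 0))"

lemma Ytilde_antimono: "k \<le> l \<Longrightarrow> Ytilde S l \<subseteq> Ytilde S k"
  by (auto simp: Ytilde_def)

lemma Y_level_unique: "\<xi> \<in> Y S k \<Longrightarrow> \<xi> \<in> Y S l \<Longrightarrow> k = l"
proof (induction k l rule: linorder_wlog)
  case (le k l)
  show ?case
  proof (rule ccontr)
    assume "k \<noteq> l"
    with le have "k \<le> l - 1" by simp
    with Ytilde_antimono[OF this, of S] le show False by (auto simp: Y_def)
  qed
qed auto

lemma Ytilde_disjoint: "k \<ge> 1 \<Longrightarrow> l \<ge> 1 \<Longrightarrow> \<xi> \<in> Ytilde S1 k \<Longrightarrow> \<xi> \<notin> Ytilde S2 l"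
  by (force simp: Ytilde_def S1_def S2_def)

lemma Y_disjoint: "k \<ge> 2 \<Longrightarrow> l \<ge> 2 \<Longrightarrow> \<xi> \<in> Y S1 k \<Longrightarrow> \<xi> \<notin> Y S2 l"
  using Ytilde_disjoint[of "k - 1" "l - 1" \<xi>] by (auto simp: Y_def)

lemma lev_eq:
  assumes "lam \<ge> 1" "k > lam" "\<xi> \<in> Y S1 k \<union> Y S2 k"
  shows "lev lam \<xi> = k"
  unfolding lev_def
proof (rule the_equality)
  fix l assume "l > lam \<and> \<xi> \<in> Y S1 l \<union> Y S2 l"
  with assms Y_disjoint[of k l \<xi>] Y_disjoint[of l k \<xi>] show "l = k"
    by (auto dest: Y_level_unique)
qed (use assms in auto)

lemma Y_not_Y0:
  assumes "k > lam" "\<xi> \<in> Y S1 k \<union> Y S2 k"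
  shows "\<xi> \<notin> Y0 lam"
proof -
  have "lam \<le> k - 1" using assms by simp
  from Ytilde_antimono[OF this, of S1] Ytilde_antimono[OF this, of S2] assms(2)
  show ?thesis by (auto simp: Y_def Y0_def)
qed

lemma Phi_clauses:
  assumes "lam \<ge> 1"
  shows "\<xi> \<in> Y0 lam \<Longrightarrow> Phi a l1 x lam \<xi> = (a, 0)"
    and "k > lam \<Longrightarrow> \<xi> \<in> Xlev k \<Longrightarrow> Phi a l1 x lam \<xi> = (x (k - lam), 0)"
    and "k > lam \<Longrightarrow> \<xi> \<in> cyl (k - 1) ptx \<inter> Y S1 k \<Longrightarrow>
           Phi a l1 x lam \<xi> = (x (k - lam), l1 (x (k - lam)))"
    and "k > lam \<Longrightarrow> \<xi> \<in> cyl (k - 1) pty \<inter> Y S2 k \<Longrightarrow>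
           Phi a l1 x lam \<xi> = (x (k - lam), - l1 (x (k - lam)))"
    and "\<xi> \<in> Yinf S1 \<union> Yinf S2 \<Longrightarrow> Phi a l1 x lam \<xi> = (0, 0)"
proof -
  show "Phi a l1 x lam \<xi> = (a, 0)" if "\<xi> \<in> Y0 lam"
    using that by (simp add: Phi_def)
  show "Phi a l1 x lam \<xi> = (x (k - lam), 0)" if k: "k > lam" "\<xi> \<in> Xlev k"
  proof -
    have Y: "\<xi> \<in> Y S1 k \<union> Y S2 k" using k by (auto simp: Xlev_def)
    have 1: "\<exists>k>lam. \<xi> \<in> Xlev k" using k by blast
    show ?thesis
      unfolding Phi_def if_not_P[OF Y_not_Y0[OF k(1) Y]] if_P[OF 1] lev_eq[OF assms k(1) Y] ..
  qed
  show "Phi a l1 x lam \<xi> = (x (k - lam), l1 (x (k - lam)))"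
    if k: "k > lam" "\<xi> \<in> cyl (k - 1) ptx \<inter> Y S1 k"
  proof -
    have Y: "\<xi> \<in> Y S1 k \<union> Y S2 k" using k by blast
    have 1: "\<not> (\<exists>l>lam. \<xi> \<in> Xlev l)"
    proof (intro notI, elim exE conjE)
      fix l assume l: "l > lam" "\<xi> \<in> Xlev l"
      then have "\<xi> \<notin> Y S2 l" using k assms by (intro Y_disjoint[of k l]) auto
      with l have "\<xi> \<in> Y S1 l" "\<xi> \<notin> cyl (l - 1) ptx" by (auto simp: Xlev_def)
      with k show False using Y_level_unique[of \<xi> S1 k l] by blast
    qed
    have 2: "\<exists>k>lam. \<xi> \<in> cyl (k - 1) ptx \<inter> Y S1 k" using k by blast
    show ?thesis
      unfolding Phi_def if_not_P[OF Y_not_Y0[OF k(1) Y]] if_not_P[OF 1] if_P[OF 2]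
        lev_eq[OF assms k(1) Y] ..
  qed
  show "Phi a l1 x lam \<xi> = (x (k - lam), - l1 (x (k - lam)))"
    if k: "k > lam" "\<xi> \<in> cyl (k - 1) pty \<inter> Y S2 k"
  proof -
    have Y: "\<xi> \<in> Y S1 k \<union> Y S2 k" using k by blast
    have N: "\<xi> \<notin> Y S1 l" if "l > lam" for l
      using Y_disjoint[of l k \<xi>] k that assms by auto
    have 1: "\<not> (\<exists>l>lam. \<xi> \<in> Xlev l)"
    proof (intro notI, elim exE conjE)
      fix l assume l: "l > lam" "\<xi> \<in> Xlev l"
      with N[OF l(1)] have "\<xi> \<in> Y S2 l" "\<xi> \<notin> cyl (l - 1) pty" by (auto simp: Xlev_def)
      with k show False using Y_level_unique[of \<xi> S2 k l] by blast
    qed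
    have 2: "\<not> (\<exists>l>lam. \<xi> \<in> cyl (l - 1) ptx \<inter> Y S1 l)" using N by blast
    have 3: "\<exists>k>lam. \<xi> \<in> cyl (k - 1) pty \<inter> Y S2 k" using k by blast
    show ?thesis
      unfolding Phi_def if_not_P[OF Y_not_Y0[OF k(1) Y]] if_not_P[OF 1] if_not_P[OF 2] if_P[OF 3]
        lev_eq[OF assms k(1) Y] ..
  qed
  show "Phi a l1 x lam \<xi> = (0, 0)" if i: "\<xi> \<in> Yinf S1 \<union> Yinf S2"
  proof -
    have Y: "\<xi> \<notin> Y S1 k \<and> \<xi> \<notin> Y S2 k" if "k > lam" for k
    proof -
      have "1 \<le> k - 1" using that assms by simp
      with i show ?thesis
        using Ytilde_disjoint[of "k - 1" 1 \<xi>] Ytilde_disjoint[of 1 "k - 1" \<xi>]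
        by (auto simp: Yinf_def Y_def)
    qed
    moreover from Y have "\<xi> \<notin> Xlev k" if "k > lam" for k
      using that by (auto simp: Xlev_def)
    moreover have "\<xi> \<notin> Y0 lam" using i by (auto simp: Yinf_def Y0_def)
    ultimately show ?thesis unfolding Phi_def by auto
  qed
qed

lemma Ytilde_split:
  assumes "lam \<le> K" "\<xi> \<in> Ytilde S lam"
  shows "\<xi> \<in> Ytilde S K \<or> (\<exists>k\<in>{lam<..K}. \<xi> \<in> Y S k)"
  using assms
proof (induction K rule: dec_induct)
  case (step n)
  then consider "\<xi> \<in> Ytilde S n" | k where "k \<in> {lam<..n}" "\<xi> \<in> Y S k" by blast
  then show ?case
  proof cases
    case 1
    then have "\<xi> \<in> Ytilde S (Suc n) \<or> \<xi> \<in> Y S (Suc n)" by (simp add: Y_def)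
    moreover have "Suc n \<in> {lam<..Suc n}" using step by simp
    ultimately show ?thesis by blast
  next
    case 2
    then have "k \<in> {lam<..Suc n}" by simp
    with 2 show ?thesis by blast
  qed
qed auto

lemma Phi_eps_cover:
  assumes "lam \<le> K"
  shows "X = Xeps lam K \<union> Y0 lam \<union> (Ytilde S1 K \<union> Ytilde S2 K)"
proof (intro equalityI subsetI)
  fix \<xi> assume "\<xi> \<in> X"
  then show "\<xi> \<in> Xeps lam K \<union> Y0 lam \<union> (Ytilde S1 K \<union> Ytilde S2 K)"
    using Ytilde_split[OF assms, of \<xi> S1] Ytilde_split[OF assms, of \<xi> S2]
    unfolding Xeps_def Xlev_def Y0_def by blast
qed (auto simp: Xeps_def Xlev_def Y0_def Y_def Ytilde_def)

lemma Phi_eps_clauses: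
  assumes "lam \<ge> 1" "K \<ge> lam"
  shows "\<xi> \<in> Xeps lam K \<union> Y0 lam \<Longrightarrow> Phi_eps a l1 x lam K \<xi> = Phi a l1 x lam \<xi>"
    and "\<xi> \<in> (Ytilde S1 K \<union> Ytilde S2 K) - (cyl K ptx \<union> cyl K pty) \<Longrightarrow>
           Phi_eps a l1 x lam K \<xi> = (x (K + 1 - lam), 0)"
    and "\<xi> \<in> cyl K ptx \<Longrightarrow> Phi_eps a l1 x lam K \<xi> = (x (K + 1 - lam), l1 (x (K + 1 - lam)))"
    and "\<xi> \<in> cyl K pty \<Longrightarrow> Phi_eps a l1 x lam K \<xi> = (x (K + 1 - lam), - l1 (x (K + 1 - lam)))"
proof -
  have D: "\<xi> \<notin> Xeps lam K \<union> Y0 lam" if T: "\<xi> \<in> Ytilde S1 K \<union> Ytilde S2 K"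
  proof -
    have "\<xi> \<notin> Y S1 k \<and> \<xi> \<notin> Y S2 k" if "k \<in> {lam<..K}" for k
    proof -
      have "1 \<le> k - 1" "1 \<le> K" "k \<le> K" using that assms by auto
      with T show ?thesis
        using Ytilde_antimono[of k K S1] Ytilde_antimono[of k K S2]
          Ytilde_disjoint[of "k - 1" K \<xi>] Ytilde_disjoint[of K "k - 1" \<xi>]
        by (auto simp: Y_def)
    qed
    moreover have "\<xi> \<notin> Y0 lam"
      using T Ytilde_antimono[OF assms(2), of S1] Ytilde_antimono[OF assms(2), of S2]
      by (auto simp: Y0_def)
    ultimately show ?thesis by (auto simp: Xeps_def Xlev_def)
  qed
  have x1: "\<xi> \<in> Ytilde S1 K" if "\<xi> \<in> cyl K ptx"
    using that by (auto simp: cyl_def Ytilde_def ptx_def S1_def)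
  have y2: "\<xi> \<in> Ytilde S2 K" if "\<xi> \<in> cyl K pty"
    using that by (auto simp: cyl_def Ytilde_def pty_def S2_def)
  have xy: "\<xi> \<notin> cyl K ptx" if "\<xi> \<in> cyl K pty"
    using x1 y2[OF that] assms Ytilde_disjoint[of K K \<xi>] by auto
  show "\<xi> \<in> Xeps lam K \<union> Y0 lam \<Longrightarrow> Phi_eps a l1 x lam K \<xi> = Phi a l1 x lam \<xi>"
    by (simp add: Phi_eps_def)
  show "\<xi> \<in> (Ytilde S1 K \<union> Ytilde S2 K) - (cyl K ptx \<union> cyl K pty) \<Longrightarrow>
      Phi_eps a l1 x lam K \<xi> = (x (K + 1 - lam), 0)"
    using D unfolding Phi_eps_def by auto
  show "\<xi> \<in> cyl K ptx \<Longrightarrow> Phi_eps a l1 x lam K \<xi> = (x (K + 1 - lam), l1 (x (K + 1 - lam)))"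
    using D x1 unfolding Phi_eps_def by auto
  show "\<xi> \<in> cyl K pty \<Longrightarrow> Phi_eps a l1 x lam K \<xi> = (x (K + 1 - lam), - l1 (x (K + 1 - lam)))"
    using D y2 xy unfolding Phi_eps_def by auto
qed

end

theory Submission
  imports Defs
begin

text \<open>
  Every approximating potential has first coordinate at least $d = x_{K+1-\lambda}$, with equality
  exactly on the points whose first $K$ symbols all lie in $S_1$ or all lie in $S_2$.

  Lower limit: the vector $(d, \ell_1(d))$ is extreme in the rotation set. A measure that realises it
  is carried by the cylinder $[1^K]$, hence by invariance it is the point mass at $(1,1,\dots)$, which
  has entropy zero.

  Upper limit: the Bernoulli$(1/2,1/2)$ measure on $\{0,1\}^{\mathbb N}$ has rotation vector $(d, v)$
  with $0 \le v \le \ell_1(d)$ and entropy $\log 2$. Conversely, if the rotation vector of $\mu$ has norm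
  at most $r$, then the first coordinate gives $\mu(Y_0(\lambda)) \le r/a$, so a symbol and its successor
  lie in different classes $S_1$, $S_2$ with probability at most $r/a$. A symbol is determined by its
  predecessor, its parity and the occurrence of such a change, so $h_\mu \le \log 2 + H(p)$ with
  $p \le r/a$ and the binary entropy $H(p) \le 2\sqrt p + p$. That the first coordinate is a generator
  follows from the submodularity of entropy and the approximation of measurable sets by cylinders.
\<close>

section \<open>Entropy of finite-valued random variables\<close>

text \<open>Shannon entropy in nats of a random variable with finitely many values. Working with
  functions instead of partitions turns common refinements into pairs and lists of values.\<close>

definition ent :: "'a measure \<Rightarrow> ('a \<Rightarrow> 'b) \<Rightarrow> real" where
  "ent M f = - (\<Sum>v\<in>f ` space M.
     measure M (f -` {v} \<inter> space M) * ln (measure M (f -` {v} \<inter> space M)))"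

lemma ent_cong:
  assumes "\<And>\<omega>. \<omega> \<in> space M \<Longrightarrow> f \<omega> = g \<omega>"
  shows "ent M f = ent M g"
proof -
  have "f ` space M = g ` space M" "\<And>v. f -` {v} \<inter> space M = g -` {v} \<inter> space M"
    using assms by auto
  then show ?thesis by (simp add: ent_def)
qed

lemma log_exp_1: "log (exp 1) x = ln x"
  by (simp add: log_def)

text \<open>\<open>ln t \<le> t - 1\<close> at t = 1 / sqrt p. The bound vanishes as p tends to 0,
  so a rare event contributes little entropy.\<close>

lemma neg_mult_ln_le_2_sqrt:
  fixes p :: real assumes "p \<ge> 0" shows "- (p * ln p) \<le> 2 * sqrt p"
proof (cases "p = 0")
  case False
  with assms have p: "p > 0" by simp
  have "ln (1 / sqrt p) \<le> 1 / sqrt p - 1" using p by (intro ln_le_minus_one) auto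
  moreover have "ln (1 / sqrt p) = - ln p / 2" using p by (simp add: ln_div ln_sqrt)
  ultimately have "- ln p \<le> 2 / sqrt p" by simp
  then have "p * (- ln p) \<le> p * (2 / sqrt p)" using p by (intro mult_left_mono) auto
  also have "p * (2 / sqrt p) = 2 * sqrt p" using p by (simp add: field_simps)
  finally show ?thesis by simp
qed simp

context prob_space
begin

text \<open>Base \<open>exp 1\<close> makes the logarithm of information theory natural, so that
  known facts on \<open>entropy\<close> carry over to \<open>ent\<close>.\<close>

lemma information_space_exp: "information_space M (exp 1)"
  by unfold_locales simp

lemma ent_eq_entropy:
  assumes "simple_function M f"
  shows "ent M f = entropy (exp 1) (count_space (f ` space M)) f"
  using information_space.entropy_simple_distributed[OF information_space_exp
      simple_distributedI[OF assms measure_nonneg refl]]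
  by (simp add: ent_def log_exp_1)

lemma ent_nonneg: "0 \<le> ent M f"
proof -
  have "p * ln p \<le> 0" if "p = prob A" for p A
    using that by (cases "p = 0") (auto intro!: mult_nonneg_nonpos measure_nonneg simp: zero_less_measure_iff prob_le_1)
  then show ?thesis unfolding ent_def by (simp add: sum_nonpos)
qed

lemma ent_le_ln_card:
  assumes "simple_function M f" "f ` space M \<subseteq> A" "finite A"
  shows "ent M f \<le> ln (card A)"
proof -
  have "ent M f \<le> ln (card (f ` space M))"
    using information_space.entropy_le_card[OF information_space_exp
        simple_distributedI[OF assms(1) measure_nonneg refl]]
    by (simp add: ent_eq_entropy assms log_exp_1)
  also have "\<dots> \<le> ln (card A)"
    using assms not_empty by (intro ln_mono) (auto simp: card_gt_0_iff card_mono finite_subset)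
  finally show ?thesis .
qed

text \<open>Since \<open>g\<close> is constant on the fibres of \<open>f\<close>, the factor map may
  evaluate it at an arbitrary point of the fibre.\<close>

lemma factor_if_determined:
  assumes "\<And>\<omega> \<omega>'. \<omega> \<in> space M \<Longrightarrow> \<omega>' \<in> space M \<Longrightarrow> f \<omega> = f \<omega>' \<Longrightarrow> g \<omega> = g \<omega>'"
  obtains \<phi> where "\<And>\<omega>. \<omega> \<in> space M \<Longrightarrow> g \<omega> = (\<phi> \<circ> f) \<omega>"
proof
  fix \<omega> assume \<omega>: "\<omega> \<in> space M"
  then have "\<exists>\<omega>'. \<omega>' \<in> space M \<and> f \<omega>' = f \<omega>" by blast
  from someI_ex[OF this] assms[OF \<omega>]
  show "g \<omega> = ((\<lambda>v. g (SOME \<omega>'. \<omega>' \<in> space M \<and> f \<omega>' = v)) \<circ> f) \<omega>"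
    by simp
qed

lemma simple_function_determined:
  assumes f: "simple_function M f"
    and d: "\<And>\<omega> \<omega>'. \<omega> \<in> space M \<Longrightarrow> \<omega>' \<in> space M \<Longrightarrow> f \<omega> = f \<omega>' \<Longrightarrow> g \<omega> = g \<omega>'"
  shows "simple_function M g"
proof (rule factor_if_determined[OF d])
  fix \<phi> assume "\<And>\<omega>. \<omega> \<in> space M \<Longrightarrow> g \<omega> = (\<phi> \<circ> f) \<omega>"
  then have "simple_function M g \<longleftrightarrow> simple_function M (\<phi> \<circ> f)"
    by (intro simple_function_cong) auto
  then show ?thesis using simple_function_compose[OF f, of \<phi>] by blast
qed

text \<open>Data processing: a function of \<open>f\<close> carries no more information than
  \<open>f\<close>. The hypothesis on pairs of points is easier to check for itineraries than an
  explicit factor map.\<close>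

lemma ent_le_if_determined:
  assumes f: "simple_function M f"
    and d: "\<And>\<omega> \<omega>'. \<omega> \<in> space M \<Longrightarrow> \<omega>' \<in> space M \<Longrightarrow> f \<omega> = f \<omega>' \<Longrightarrow> g \<omega> = g \<omega>'"
  shows "ent M g \<le> ent M f"
proof (rule factor_if_determined[OF d])
  fix \<phi> assume \<phi>: "\<And>\<omega>. \<omega> \<in> space M \<Longrightarrow> g \<omega> = (\<phi> \<circ> f) \<omega>"
  have "ent M g = ent M (\<phi> \<circ> f)" using \<phi> by (intro ent_cong)
  also have "\<dots> \<le> ent M f"
    using information_space.entropy_data_processing[OF information_space_exp f, of \<phi>]
    by (simp only: ent_eq_entropy f simple_function_compose[OF f])
  finally show ?thesis .
qed

lemma sum_fibres_comp:
  assumes f: "simple_function M f"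
  shows "(\<Sum>v\<in>f ` space M. prob (f -` {v} \<inter> space M) * h (\<phi> v)) =
    (\<Sum>u\<in>(\<phi> \<circ> f) ` space M. prob ((\<phi> \<circ> f) -` {u} \<inter> space M) * h u)"
proof -
  let ?S = "f ` space M"
  have fin: "finite ?S" using f by (simp add: simple_functionD)
  have "(\<Sum>v\<in>?S. prob (f -` {v} \<inter> space M) * h (\<phi> v)) =
    (\<Sum>u\<in>\<phi> ` ?S. \<Sum>v\<in>{v\<in>?S. \<phi> v = u}. prob (f -` {v} \<inter> space M) * h (\<phi> v))"
    by (rule sum.image_gen[OF fin])
  also have "\<dots> = (\<Sum>u\<in>\<phi> ` ?S. prob ((\<phi> \<circ> f) -` {u} \<inter> space M) * h u)"
  proof (rule sum.cong[OF refl])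
    fix u assume "u \<in> \<phi> ` ?S"
    have "(\<Sum>v\<in>{v\<in>?S. \<phi> v = u}. prob (f -` {v} \<inter> space M) * h (\<phi> v)) =
      (\<Sum>v\<in>{v\<in>?S. \<phi> v = u}. prob (f -` {v} \<inter> space M)) * h u"
      by (simp add: sum_distrib_right)
    also have "(\<Sum>v\<in>{v\<in>?S. \<phi> v = u}. prob (f -` {v} \<inter> space M)) =
      prob (\<Union>v\<in>{v\<in>?S. \<phi> v = u}. f -` {v} \<inter> space M)"
      using fin f by (subst finite_measure_finite_Union)
        (auto simp: disjoint_family_on_def simple_functionD)
    also have "(\<Union>v\<in>{v\<in>?S. \<phi> v = u}. f -` {v} \<inter> space M) = (\<phi> \<circ> f) -` {u} \<inter> space M"
      by auto
    finally show "(\<Sum>v\<in>{v\<in>?S. \<phi> v = u}. prob (f -` {v} \<inter> space M) * h (\<phi> v)) =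
      prob ((\<phi> \<circ> f) -` {u} \<inter> space M) * h u" .
  qed
  finally show ?thesis by (simp add: image_comp)
qed

text \<open>Lets the entropies of several marginals be written as sums over one index set, the
  values of the joint variable, and so be combined term by term.\<close>

lemma ent_comp:
  assumes f: "simple_function M f"
  shows "ent M (\<phi> \<circ> f) = - (\<Sum>v\<in>f ` space M. prob (f -` {v} \<inter> space M) *
    ln (prob ((\<phi> \<circ> f) -` {\<phi> v} \<inter> space M)))"
  unfolding ent_def sum_fibres_comp[OF f, where h="\<lambda>u. ln (prob ((\<phi> \<circ> f) -` {u} \<inter> space M))"] ..

section \<open>Submodularity and upper bounds for entropy\<close>

text \<open>Nonnegativity of the conditional mutual information I(u;v|q) = H(u,q) + H(v,q) -
  H(u,v,q) - H(q).\<close>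

lemma ent_submodular_triple:
  assumes u: "simple_function M u" and v: "simple_function M v" and q: "simple_function M q"
  shows "ent M (\<lambda>\<omega>. (u \<omega>, v \<omega>, q \<omega>)) + ent M q \<le>
    ent M (\<lambda>\<omega>. (u \<omega>, q \<omega>)) + ent M (\<lambda>\<omega>. (v \<omega>, q \<omega>))"
proof -
  interpret I: information_space M "exp 1" by (rule information_space_exp)
  let ?f = "\<lambda>\<omega>. (u \<omega>, v \<omega>, q \<omega>)"
  let ?p = "\<lambda>z. prob (?f -` {z} \<inter> space M)"
  let ?pm = "\<lambda>\<phi> z. prob ((\<phi> \<circ> ?f) -` {\<phi> z} \<inter> space M)"
  let ?uq = "\<lambda>(x, y, z). (x, z)" and ?vq = "\<lambda>(x, y, z). (y, z)" and ?q = "\<lambda>(x, y, z). z"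
  have f: "simple_function M ?f" using u v q by (intro simple_function_Pair)
  have sd: "simple_distributed M h (\<lambda>z. prob (h -` {z} \<inter> space M))" if "simple_function M h"
    for h :: "_ \<Rightarrow> 'z" by (rule simple_distributedI[OF that measure_nonneg refl])
  have le: "?p z \<le> ?pm \<phi> z" for z and \<phi> :: "_ \<Rightarrow> 'y"
    using f simple_function_compose[OF f, of \<phi>]
    by (intro finite_measure_mono) (auto simp: simple_functionD)
  have "0 \<le> conditional_mutual_information (exp 1) (count_space (u ` space M))
      (count_space (v ` space M)) (count_space (q ` space M)) u v q"
    by (rule I.conditional_mutual_information_nonneg[OF u v q])
  also have "\<dots> = (\<Sum>(x, y, z)\<in>?f ` space M. ?p (x, y, z) * ln (?p (x, y, z) /
      (prob ((\<lambda>\<omega>. (u \<omega>, q \<omega>)) -` {(x, z)} \<inter> space M) *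
       (prob ((\<lambda>\<omega>. (v \<omega>, q \<omega>)) -` {(y, z)} \<inter> space M) / prob (q -` {z} \<inter> space M)))))"
    using I.conditional_mutual_information_eq[OF sd[OF q] sd[OF simple_function_Pair[OF v q]]
        sd[OF simple_function_Pair[OF u q]] sd[OF f]]
    by (simp only: log_exp_1)
  also have "\<dots> = (\<Sum>z\<in>?f ` space M. ?p z * ln (?p z / (?pm ?uq z * (?pm ?vq z / ?pm ?q z))))"
    by (intro sum.cong) (auto simp: comp_def)
  also have "\<dots> = (\<Sum>z\<in>?f ` space M. ?p z * ln (?p z) - ?p z * ln (?pm ?uq z)
      - ?p z * ln (?pm ?vq z) + ?p z * ln (?pm ?q z))"
  proof (intro sum.cong refl)
    fix z
    show "?p z * ln (?p z / (?pm ?uq z * (?pm ?vq z / ?pm ?q z))) =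
      ?p z * ln (?p z) - ?p z * ln (?pm ?uq z) - ?p z * ln (?pm ?vq z) + ?p z * ln (?pm ?q z)"
    \<comment> \<open>Where the joint probability vanishes both sides are 0. Elsewhere the marginals
      dominate it, hence are positive, and the logarithm splits.\<close>
    proof (cases "?p z = 0")
      case False
      then have pos: "?p z > 0" by (simp add: zero_less_measure_iff)
      with le[of z ?uq] le[of z ?vq] le[of z ?q]
      have "?pm ?uq z > 0" "?pm ?vq z > 0" "?pm ?q z > 0" by linarith+
      with pos show ?thesis by (simp only: ln_div ln_mult mult_pos_pos divide_pos_pos) (simp add: algebra_simps)
    qed simp
  qed
  also have "\<dots> = - ent M ?f + ent M (?uq \<circ> ?f) + ent M (?vq \<circ> ?f) - ent M (?q \<circ> ?f)"
    unfolding ent_comp[OF f] by (simp add: ent_def sum.distrib sum_subtractf)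
  finally show ?thesis by (simp add: comp_def)
qed

text \<open>Conditioning on more leaves less uncertainty: this is H(v|u) \<le> H(v|q) without
  conditional entropies. Since \<open>u\<close> determines \<open>q\<close>, H(u,q) does not exceed
  H(u).\<close>

lemma ent_submodular:
  assumes u: "simple_function M u" and v: "simple_function M v"
    and d: "\<And>\<omega> \<omega>'. \<omega> \<in> space M \<Longrightarrow> \<omega>' \<in> space M \<Longrightarrow> u \<omega> = u \<omega>' \<Longrightarrow> q \<omega> = q \<omega>'"
  shows "ent M (\<lambda>\<omega>. (u \<omega>, v \<omega>)) + ent M q \<le> ent M u + ent M (\<lambda>\<omega>. (v \<omega>, q \<omega>))"
proof -
  have q: "simple_function M q" by (rule simple_function_determined[OF u d])
  have "ent M (\<lambda>\<omega>. (u \<omega>, v \<omega>)) \<le> ent M (\<lambda>\<omega>. (u \<omega>, v \<omega>, q \<omega>))"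
    using u v q by (intro ent_le_if_determined simple_function_Pair) auto
  moreover have "ent M (\<lambda>\<omega>. (u \<omega>, q \<omega>)) \<le> ent M u"
    by (rule ent_le_if_determined[OF u]) (simp, blast intro: d)
  ultimately show ?thesis using ent_submodular_triple[OF u v q] by linarith
qed

lemma ent_const_eq_0: "ent M (\<lambda>_. c) = 0"
  using not_empty by (simp add: ent_def image_constant_conv prob_space vimage_def)

text \<open>Submodularity with a constant \<open>q\<close>, whose entropy is 0.\<close>

lemma ent_pair_le:
  assumes u: "simple_function M u" and v: "simple_function M v"
  shows "ent M (\<lambda>\<omega>. (u \<omega>, v \<omega>)) \<le> ent M u + ent M v"
proof -
  have "ent M (\<lambda>\<omega>. (v \<omega>, ())) \<le> ent M v" by (intro ent_le_if_determined[OF v]) auto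
  then show ?thesis
    using ent_submodular[OF u v, of "\<lambda>_. ()"] ent_const_eq_0[of "()"] by simp
qed

lemma ent_comp_measure_preserving:
  assumes f: "simple_function M f" and T: "T \<in> measurable M M" "distr M M T = M"
  shows "ent M (\<lambda>\<omega>. f (T \<omega>)) = ent M f"
proof -
  have p: "prob ((\<lambda>\<omega>. f (T \<omega>)) -` {v} \<inter> space M) = prob (f -` {v} \<inter> space M)" for v
  proof -
    have "f -` {v} \<inter> space M \<in> sets M" using f by (simp add: simple_functionD)
    then have "measure (distr M M T) (f -` {v} \<inter> space M) =
        prob (T -` (f -` {v} \<inter> space M) \<inter> space M)"
      by (rule measure_distr[OF T(1)])
    also have "T -` (f -` {v} \<inter> space M) \<inter> space M = (\<lambda>\<omega>. f (T \<omega>)) -` {v} \<inter> space M"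
      using measurable_space[OF T(1)] by auto
    finally show ?thesis by (simp only: T(2))
  qed
  \<comment> \<open>\<open>T\<close> need not be onto: values of \<open>f\<close> that are missed
    after \<open>T\<close> have probability 0 and do not change the sum.\<close>
  have "prob ((\<lambda>\<omega>. f (T \<omega>)) -` {v} \<inter> space M) = 0" if "v \<notin> (\<lambda>\<omega>. f (T \<omega>)) ` space M" for v
  proof -
    have "(\<lambda>\<omega>. f (T \<omega>)) -` {v} \<inter> space M = {}" using that by auto
    then show ?thesis by (simp only: measure_empty)
  qed
  then show ?thesis
    unfolding ent_def p using f measurable_space[OF T(1)]
    by (intro arg_cong[where f=uminus] sum.mono_neutral_left) (auto simp: simple_functionD)
qed

text \<open>Both terms of the binary entropy are bounded through \<open>ln t \<le> t - 1\<close>: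
  one by 2 sqrt p, the other by p. These bounds increase with p, so an upper estimate of the
  probability suffices.\<close>

lemma ent_indicator_le:
  assumes A: "A \<in> events" "prob A \<le> p"
  shows "ent M (\<lambda>\<omega>. \<omega> \<in> A) \<le> 2 * sqrt p + p"
proof -
  let ?f = "\<lambda>\<omega>. \<omega> \<in> A"
  define g where "g = (\<lambda>v. prob (?f -` {v} \<inter> space M) * ln (prob (?f -` {v} \<inter> space M)))"
  have T: "?f -` {True} \<inter> space M = A" using A sets.sets_into_space by auto
  have F: "?f -` {False} \<inter> space M = space M - A" by auto
  have "g v = 0" if "v \<notin> ?f ` space M" for v
  proof -
    have "?f -` {v} \<inter> space M = {}" using that by auto
    then show ?thesis by (simp only: g_def measure_empty)
  qed
  then have "sum g (?f ` space M) = sum g UNIV" by (intro sum.mono_neutral_left) auto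
  then have "ent M ?f = - sum g UNIV" by (simp add: ent_def g_def)
  also have "\<dots> = - (prob A * ln (prob A)) - (1 - prob A) * ln (1 - prob A)"
    using T F by (simp add: UNIV_bool g_def prob_compl A)
  finally have 1: "ent M ?f = - (prob A * ln (prob A)) - (1 - prob A) * ln (1 - prob A)" .
  have 2: "- (prob A * ln (prob A)) \<le> 2 * sqrt (prob A)"
    by (rule neg_mult_ln_le_2_sqrt) simp
  have 3: "- ((1 - prob A) * ln (1 - prob A)) \<le> prob A"
  proof (cases "prob A = 1")
    case False
    then have q: "1 - prob A > 0" using prob_le_1[of A] by linarith
    have "ln (1 / (1 - prob A)) \<le> 1 / (1 - prob A) - 1" using q by (intro ln_le_minus_one) auto
    then have "- ln (1 - prob A) \<le> 1 / (1 - prob A) - 1" using q by (simp add: ln_div)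
    then have "(1 - prob A) * (- ln (1 - prob A)) \<le> (1 - prob A) * (1 / (1 - prob A) - 1)"
      using q by (intro mult_left_mono) auto
    also have "\<dots> = prob A" using q by (simp add: field_simps)
    finally show ?thesis by simp
  qed simp
  have "sqrt (prob A) \<le> sqrt p" using A by simp
  then show ?thesis using 1 2 3 A(2) by linarith
qed

end

lemma (in prob_space) ent_AE_const:
  assumes f: "simple_function M f" and c: "AE \<omega> in M. f \<omega> = c"
  shows "ent M f = 0"
proof -
  have "prob (f -` {v} \<inter> space M) = (if v = c then 1 else 0)" for v
  proof -
    have "prob (f -` {v} \<inter> space M) = prob (if v = c then space M else {})"
      using c by (intro measure_eq_AE) (use simple_functionD(2)[OF f, of "{v}"] in \<open>auto elim!: AE_mp\<close>)
    then show ?thesis by (simp add: prob_space)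
  qed
  then show ?thesis unfolding ent_def by (simp add: sum.neutral)
qed

lemma (in prob_space) integrable_simple:
  fixes f :: "'a \<Rightarrow> real"
  assumes "simple_function M f"
  shows "integrable M f"
proof (rule integrable_const_bound)
  show "AE \<omega> in M. norm (f \<omega>) \<le> Max ((\<lambda>\<omega>. \<bar>f \<omega>\<bar>) ` space M)"
  proof (rule AE_I2)
    fix \<omega> assume "\<omega> \<in> space M"
    moreover have "finite ((\<lambda>\<omega>. \<bar>f \<omega>\<bar>) ` space M)"
      using finite_imageI[OF simple_functionD(1)[OF assms], of abs] by (simp add: image_image)
    ultimately show "norm (f \<omega>) \<le> Max ((\<lambda>\<omega>. \<bar>f \<omega>\<bar>) ` space M)" by (auto intro: Max_ge)
  qed
qed (rule borel_measurable_simple_function[OF assms])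

section \<open>Entropy of measure-preserving systems\<close>

text \<open>Fekete's lemma, with the infimum \<open>L\<close> as the limit. It gives meaning to the
  \<open>lim\<close> in \<open>entropy_wrt\<close>.\<close>

lemma subadditive_convergent:
  fixes u :: "nat \<Rightarrow> real"
  assumes nonneg: "\<And>n. 0 \<le> u n" and sub: "\<And>m n. u (m + n) \<le> u m + u n"
  shows "convergent (\<lambda>n. u n / real n)"
proof -
  define L where "L = (INF n\<in>{1..}. u n / real n)"
  have bdd: "bdd_below ((\<lambda>n. u n / real n) ` {1..})"
    by (rule bdd_belowI2[of _ 0]) (simp add: nonneg)
  have L_le: "L \<le> u n / real n" if "n \<ge> 1" for n
    unfolding L_def using that by (intro cINF_lower[OF bdd]) auto
  have mult: "u (q * m) \<le> real q * u m" if "q \<ge> 1" for q m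
    using that
  proof (induction q rule: dec_induct)
    case (step q)
    then show ?case using sub[of m "q * m"] by (simp add: algebra_simps)
  qed simp
  have "(\<lambda>n. u n / real n) \<longlonglongrightarrow> L"
  proof (rule LIMSEQ_I)
    fix e :: real assume e: "e > 0"
    have "\<exists>m\<in>{1..}. u m / real m < L + e / 2"
      unfolding L_def using e L_def by (subst cINF_less_iff[OF _ bdd, symmetric]) auto
    then obtain m where m: "m \<ge> 1" "u m / real m < L + e / 2" by auto
    \<comment> \<open>\<open>C\<close> bounds \<open>u\<close> at every remainder modulo
      \<open>m\<close> at once.\<close>
    define C where "C = (\<Sum>r<m. u r)"
    have C: "u r \<le> C" if "r < m" for r
      unfolding C_def using that by (intro member_le_sum) (auto simp: nonneg)
    obtain n0 :: nat where n0: "C / (e / 2) < real n0" using reals_Archimedean2 by blast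
    show "\<exists>n0. \<forall>n\<ge>n0. norm (u n / real n - L) < e"
    proof (intro exI allI impI)
      \<comment> \<open>The summand \<open>m\<close> makes the quotient \<open>q\<close> positive;
        \<open>n0\<close> makes the remainder term \<open>C / n\<close> smaller than
        \<open>e / 2\<close>.\<close>
      fix n assume n: "n \<ge> n0 + m"
      then have pos: "n \<ge> 1" using m by simp
      define q where "q = n div m"
      have q: "q \<ge> 1" using n m by (simp add: q_def div_greater_zero_iff Suc_le_eq)
      have "u n = u (q * m + n mod m)" by (simp add: q_def)
      also have "\<dots> \<le> real q * u m + C"
        using sub[of "q * m" "n mod m"] mult[OF q, of m] C[of "n mod m"] m by simp
      also have "real q * u m = real q * real m * (u m / real m)" using m by simp
      also have "\<dots> \<le> real n * (u m / real m)"
        using nonneg[of m] by (intro mult_right_mono) (auto simp: q_def simp flip: of_nat_mult)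
      finally have "u n / real n \<le> u m / real m + C / real n"
        using pos by (simp add: field_simps)
      moreover have "C / real n < e / 2"
      proof -
        have "C < e / 2 * real n0" using n0 e by (simp add: field_simps)
        also have "\<dots> \<le> e / 2 * real n" using n e by (intro mult_left_mono) auto
        finally show ?thesis using pos by (simp add: field_simps)
      qed
      ultimately have "u n / real n - L < e" using m(2) by linarith
      then show "norm (u n / real n - L) < e" using L_le[OF pos] by simp
    qed
  qed
  then show ?thesis by (rule convergentI)
qed

section \<open>Itineraries, joins and partition entropy\<close>

text \<open>As a random variable this encodes the common refinement of \<open>n\<close> preimages of
  the partition into fibres of \<open>f\<close>; one list type serves all \<open>n\<close>.\<close>

definition itin :: "('a \<Rightarrow> 'a) \<Rightarrow> ('a \<Rightarrow> 'b) \<Rightarrow> nat \<Rightarrow> 'a \<Rightarrow> 'b list" where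
  "itin T f n \<omega> = map (\<lambda>i. f ((T ^^ i) \<omega>)) [0..<n]"

lemma length_itin [simp]: "length (itin T f n \<omega>) = n"
  by (simp add: itin_def)

lemma nth_itin [simp]: "i < n \<Longrightarrow> itin T f n \<omega> ! i = f ((T ^^ i) \<omega>)"
  by (simp add: itin_def)

lemma take_itin: "m \<le> n \<Longrightarrow> take m (itin T f n \<omega>) = itin T f m \<omega>"
  by (simp add: itin_def take_map)

lemma itin_eq_iff:
  "itin T f n \<omega> = itin T f n \<omega>' \<longleftrightarrow> (\<forall>i<n. f ((T ^^ i) \<omega>) = f ((T ^^ i) \<omega>'))"
  by (simp add: list_eq_iff_nth_eq)

text \<open>For a partition this is the singleton of the block containing the point. It makes sense
  for any family of sets, which permits induction on the family.\<close>

definition cell :: "'a set set \<Rightarrow> 'a \<Rightarrow> 'a set set" where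
  "cell \<alpha> \<omega> = {A\<in>\<alpha>. \<omega> \<in> A}"

lemma cell_eq_iff:
  assumes "partition_on S \<alpha>" "A \<in> \<alpha>" "\<omega> \<in> A"
  shows "cell \<alpha> \<omega>' = cell \<alpha> \<omega> \<longleftrightarrow> \<omega>' \<in> A"
proof -
  have "cell \<alpha> \<omega> = {A}"
    using assms by (auto simp: cell_def partition_on_def disjoint_def)
  moreover have "cell \<alpha> \<omega>' = {A}" if "\<omega>' \<in> A"
    using assms that by (auto simp: cell_def partition_on_def disjoint_def)
  ultimately show ?thesis by (auto simp: cell_def)
qed

lemma (in prob_space) simple_function_cell:
  assumes "finite \<alpha>" "\<alpha> \<subseteq> events"
  shows "simple_function M (cell \<alpha>)"
  using assms
proof (induction \<alpha>)
  case empty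
  have "cell {} = (\<lambda>_ :: 'a. {})" by (simp add: cell_def fun_eq_iff)
  then show ?case by simp
next
  case (insert A \<alpha>)
  have "simple_function M (\<lambda>\<omega>. \<omega> \<in> A)"
    unfolding simple_function_def
  proof (intro conjI ballI)
    fix v
    have "(\<lambda>\<omega>. \<omega> \<in> A) -` {v} \<inter> space M = (if v then A else space M - A)"
      using insert sets.sets_into_space by auto
    then show "(\<lambda>\<omega>. \<omega> \<in> A) -` {v} \<inter> space M \<in> events" using insert by auto
  qed auto
  with insert have "simple_function M (\<lambda>\<omega>. (\<omega> \<in> A, cell \<alpha> \<omega>))"
    by (intro simple_function_Pair) auto
  then show ?case by (rule simple_function_determined) (auto simp: cell_def)
qed

locale measure_preserving_system = prob_space M for M :: "'a measure" +
  fixes T :: "'a \<Rightarrow> 'a"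
  assumes measurable_T: "T \<in> measurable M M" and distr_T: "distr M M T = M"
begin

lemma measurable_T_pow: "T ^^ n \<in> measurable M M"
proof (induction n)
  case (Suc n)
  then show ?case using measurable_comp[OF Suc measurable_T] by (simp del: o_apply add: comp_assoc)
qed (simp add: id_def)

lemma T_pow_space: "\<omega> \<in> space M \<Longrightarrow> (T ^^ n) \<omega> \<in> space M"
  using measurable_space[OF measurable_T_pow] .

lemma distr_T_pow: "distr M M (T ^^ n) = M"
proof (induction n)
  case (Suc n)
  have "distr M M (T ^^ Suc n) = distr (distr M M (T ^^ n)) M T"
    by (simp add: distr_distr[OF measurable_T measurable_T_pow] del: o_apply)
  then show ?case by (simp only: Suc distr_T)
qed (simp add: id_def)

lemma simple_function_T_pow:
  assumes "simple_function M f"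
  shows "simple_function M (\<lambda>\<omega>. f ((T ^^ n) \<omega>))"
proof -
  have "f \<in> measurable M (count_space UNIV)" using assms by (rule measurable_simple_function)
  then have "(\<lambda>\<omega>. f ((T ^^ n) \<omega>)) \<in> measurable M (count_space UNIV)"
    by (rule measurable_compose[OF measurable_T_pow])
  moreover have "finite ((\<lambda>\<omega>. f ((T ^^ n) \<omega>)) ` space M)"
    using T_pow_space by (intro finite_subset[OF _ simple_functionD(1)[OF assms]]) auto
  ultimately show ?thesis unfolding simple_function_def by auto
qed

lemma ent_T_pow: "simple_function M f \<Longrightarrow> ent M (\<lambda>\<omega>. f ((T ^^ n) \<omega>)) = ent M f"
  by (rule ent_comp_measure_preserving[OF _ measurable_T_pow distr_T_pow])

lemma simple_function_itin: "simple_function M f \<Longrightarrow> simple_function M (itin T f n)"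
proof (induction n)
  case 0
  have "itin T f 0 = (\<lambda>_. [])" by (simp add: itin_def fun_eq_iff)
  then show ?case by simp
next
  case (Suc n)
  then have "simple_function M (\<lambda>\<omega>. (itin T f n \<omega>, f ((T ^^ n) \<omega>)))"
    by (intro simple_function_Pair simple_function_T_pow)
  then show ?case by (rule simple_function_determined) (simp add: itin_eq_iff less_Suc_eq)
qed

text \<open>Split the itinerary at time \<open>m\<close>: the second piece is an itinerary of length
  \<open>n\<close> started at time \<open>m\<close>, and by invariance it has the entropy of one
  started at time 0.\<close>

lemma ent_itin_add_le:
  assumes f: "simple_function M f"
  shows "ent M (itin T f (m + n)) \<le> ent M (itin T f m) + ent M (itin T f n)"
proof -
  note s = simple_function_itin[OF f]
  note s' = simple_function_T_pow[OF s]
  have "ent M (itin T f (m + n)) \<le> ent M (\<lambda>\<omega>. (itin T f m \<omega>, itin T f n ((T ^^ m) \<omega>)))"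
  proof (rule ent_le_if_determined[OF simple_function_Pair[OF s s']])
    fix \<omega> \<omega>'
    assume "(itin T f m \<omega>, itin T f n ((T ^^ m) \<omega>)) = (itin T f m \<omega>', itin T f n ((T ^^ m) \<omega>'))"
    then have 1: "\<forall>i<m. f ((T ^^ i) \<omega>) = f ((T ^^ i) \<omega>')"
      and 2: "\<forall>i<n. f ((T ^^ (i + m)) \<omega>) = f ((T ^^ (i + m)) \<omega>')"
      by (simp_all add: itin_eq_iff funpow_add)
    have "f ((T ^^ i) \<omega>) = f ((T ^^ i) \<omega>')" if "i < m + n" for i
      using 1[rule_format, of i] 2[rule_format, of "i - m"] that by (cases "i < m") auto
    then show "itin T f (m + n) \<omega> = itin T f (m + n) \<omega>'" by (simp add: itin_eq_iff)
  qed
  also have "\<dots> \<le> ent M (itin T f m) + ent M (\<lambda>\<omega>. itin T f n ((T ^^ m) \<omega>))"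
    by (rule ent_pair_le[OF s s'])
  finally show ?thesis by (simp add: ent_T_pow[OF s])
qed

text \<open>A nonempty block of the join is the fibre of the itinerary through any of its points.
  Entropies of joins thus become \<open>ent\<close> of itineraries.\<close>

lemma iterated_join_eq:
  assumes \<alpha>: "partition_on (space M) \<alpha>"
  shows "iterated_join M T \<alpha> n =
    (\<lambda>v. itin T (cell \<alpha>) n -` {v} \<inter> space M) ` itin T (cell \<alpha>) n ` space M"
proof -
  let ?g = "itin T (cell \<alpha>) n"
  have fib: "space M \<inter> (\<Inter>i<n. (T ^^ i) -` A i) = ?g -` {?g \<omega>} \<inter> space M"
    if A: "\<forall>i<n. A i \<in> \<alpha>" and \<omega>: "\<omega> \<in> space M" "\<forall>i<n. (T ^^ i) \<omega> \<in> A i" for A \<omega>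
  proof -
    have "?g \<omega>' = ?g \<omega> \<longleftrightarrow> (\<forall>i<n. (T ^^ i) \<omega>' \<in> A i)" for \<omega>'
      unfolding itin_eq_iff using cell_eq_iff[OF \<alpha>] A \<omega>(2) by blast
    then show ?thesis by auto
  qed
  show ?thesis
  proof (intro equalityI subsetI)
    fix B assume "B \<in> iterated_join M T \<alpha> n"
    then obtain A where A: "B = space M \<inter> (\<Inter>i<n. (T ^^ i) -` A i)" "\<forall>i<n. A i \<in> \<alpha>" "B \<noteq> {}"
      by (auto simp: iterated_join_def)
    then obtain \<omega> where \<omega>: "\<omega> \<in> space M" "\<forall>i<n. (T ^^ i) \<omega> \<in> A i" by auto
    show "B \<in> (\<lambda>v. ?g -` {v} \<inter> space M) ` ?g ` space M"
      using A(1) fib[OF A(2) \<omega>] \<omega>(1) by blast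
  next
    fix B assume "B \<in> (\<lambda>v. ?g -` {v} \<inter> space M) ` ?g ` space M"
    then obtain \<omega> where \<omega>: "\<omega> \<in> space M" "B = ?g -` {?g \<omega>} \<inter> space M" by blast
    have "\<exists>A\<in>\<alpha>. (T ^^ i) \<omega> \<in> A" for i
      using T_pow_space[OF \<omega>(1)] \<alpha> by (auto simp: partition_on_def)
    then obtain A where A: "\<And>i. A i \<in> \<alpha>" "\<And>i. (T ^^ i) \<omega> \<in> A i" by metis
    have "B = space M \<inter> (\<Inter>i<n. (T ^^ i) -` A i)" using fib[of A \<omega>] A \<omega> by auto
    moreover have "B \<noteq> {}" using \<omega> by auto
    ultimately show "B \<in> iterated_join M T \<alpha> n" using A by (auto simp: iterated_join_def)
  qed
qed

lemma partition_entropy_iterated_join: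
  assumes \<alpha>: "partition_on (space M) \<alpha>"
  shows "partition_entropy M (iterated_join M T \<alpha> n) = ent M (itin T (cell \<alpha>) n)"
proof -
  have "inj_on (\<lambda>v. itin T (cell \<alpha>) n -` {v} \<inter> space M) (itin T (cell \<alpha>) n ` space M)"
    by (auto simp: inj_on_def)
  then show ?thesis
    by (simp add: partition_entropy_def iterated_join_eq[OF \<alpha>] sum.reindex ent_def)
qed

lemma entropy_wrt_limit:
  assumes \<alpha>: "fin_partition M \<alpha>"
  shows "(\<lambda>n. ent M (itin T (cell \<alpha>) n) / real n) \<longlonglongrightarrow> entropy_wrt M T \<alpha>"
proof -
  have "simple_function M (cell \<alpha>)" using \<alpha> by (auto simp: fin_partition_def simple_function_cell)
  then have "convergent (\<lambda>n. ent M (itin T (cell \<alpha>) n) / real n)"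
    by (intro subadditive_convergent ent_nonneg ent_itin_add_le)
  then show ?thesis
    using \<alpha> by (simp add: convergent_LIMSEQ_iff entropy_wrt_def fin_partition_def
        partition_entropy_iterated_join)
qed

text \<open>The one-block partition has constant itineraries, hence entropy 0, and it competes in
  the supremum.\<close>

lemma ks_entropy_nonneg: "0 \<le> ks_entropy M T"
proof -
  have p: "fin_partition M {space M}"
    using not_empty by (auto simp: fin_partition_def partition_on_def disjoint_def)
  have "ent M (itin T (cell {space M}) n) = ent M (\<lambda>_. replicate n {space M})" for n
    by (rule ent_cong) (auto simp: list_eq_iff_nth_eq cell_def T_pow_space)
  then have "(\<lambda>n. 0) \<longlonglongrightarrow> entropy_wrt M T {space M}"
    using entropy_wrt_limit[OF p] by (simp add: ent_const_eq_0)
  then have "entropy_wrt M T {space M} = 0" using LIMSEQ_unique tendsto_const by blast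
  moreover have "ereal (entropy_wrt M T {space M}) \<le> ks_entropy M T"
    unfolding ks_entropy_def using p by (intro SUP_upper) simp
  ultimately show ?thesis by (simp add: zero_ereal_def)
qed

section \<open>Generators and the upper bound for the entropy of a system\<close>

text \<open>The sets approximable by events readable off finite itineraries contain the generators
  and are stable under complements and countable unions.\<close>

lemma itin_approximation:
  assumes Z: "simple_function M Z"
    and gen: "events = sigma_sets (space M) {{\<omega>\<in>space M. Z ((T ^^ i) \<omega>) \<in> B} | i B. True}"
    and A: "A \<in> events" and e: "e > 0"
  shows "\<exists>N F. prob (sym_diff A {\<omega>\<in>space M. itin T Z N \<omega> \<in> F}) < e"
proof -
  have cyl: "{\<omega>\<in>space M. itin T Z N \<omega> \<in> F} \<in> events" for N F
    using simple_functionD(2)[OF simple_function_itin[OF Z], of N F]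
    by (simp add: vimage_def Int_def conj_commute)
  have "A \<in> sigma_sets (space M) {{\<omega>\<in>space M. Z ((T ^^ i) \<omega>) \<in> B} | i B. True}"
    using A gen by simp
  then show ?thesis using e
  proof (induction A arbitrary: e rule: sigma_sets.induct)
    case (Basic A)
    then obtain i B where AB: "A = {\<omega>\<in>space M. Z ((T ^^ i) \<omega>) \<in> B}" by blast
    have "sym_diff A {\<omega>\<in>space M. itin T Z (Suc i) \<omega> \<in> {l. l ! i \<in> B}} = {}" by (auto simp: AB)
    then have "prob (sym_diff A {\<omega>\<in>space M. itin T Z (Suc i) \<omega> \<in> {l. l ! i \<in> B}}) < e"
      using Basic by (simp only: measure_empty)
    then show ?case by blast
  next
    case Empty
    have "prob (sym_diff {} {\<omega>\<in>space M. itin T Z 0 \<omega> \<in> {}}) < e" using Empty by simp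
    then show ?case by blast
  next
    case (Compl A)
    then obtain N F where NF: "prob (sym_diff A {\<omega>\<in>space M. itin T Z N \<omega> \<in> F}) < e" by blast
    have "A \<subseteq> space M" using Compl(1) gen sets.sets_into_space by blast
    then have "sym_diff (space M - A) {\<omega>\<in>space M. itin T Z N \<omega> \<in> - F} =
        sym_diff A {\<omega>\<in>space M. itin T Z N \<omega> \<in> F}" by auto
    with NF have "prob (sym_diff (space M - A) {\<omega>\<in>space M. itin T Z N \<omega> \<in> - F}) < e"
      by (simp only:)
    then show ?case by blast
  next
    case (Union A)
    have ev: "A i \<in> events" for i using Union(1) gen by simp
    \<comment> \<open>Continuity from below cuts the countable union down to finitely many sets at a
      cost below \<open>e / 2\<close>.\<close>
    have "(\<lambda>n. prob (\<Union>i<n. A i)) \<longlonglongrightarrow> prob (\<Union>n. \<Union>i<n. A i)"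
      using ev by (intro finite_Lim_measure_incseq) (auto simp: incseq_def, force)
    moreover have "(\<Union>n. \<Union>i<n. A i) = (\<Union>i. A i)" by auto
    ultimately have "\<forall>\<^sub>F n in sequentially. prob (\<Union>i. A i) - e / 2 < prob (\<Union>i<n. A i)"
      using Union.prems by (intro order_tendstoD(1)) auto
    then have "\<exists>n. prob (\<Union>i. A i) - e / 2 < prob (\<Union>i<n. A i)"
      by (rule eventually_happens'[OF trivial_limit_sequentially])
    then obtain n where "prob (\<Union>i. A i) - e / 2 < prob (\<Union>i<n. A i)" by (rule exE)
    then have n: "prob (\<Union>i. A i) - prob (\<Union>i<n. A i) < e / 2" by linarith
    \<comment> \<open>The \<open>n\<close> errors below \<delta> add up to at most
      \<open>e / 2\<close>; \<open>Suc n\<close> keeps the denominator positive for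
      \<open>n = 0\<close>.\<close>
    define \<delta> where "\<delta> = e / (2 * real (Suc n))"
    have \<delta>: "\<delta> > 0" using Union.prems by (simp add: \<delta>_def)
    have "\<forall>i. \<exists>p. prob (sym_diff (A i) {\<omega>\<in>space M. itin T Z (fst p) \<omega> \<in> snd p}) < \<delta>"
    proof
      fix i
      from Union.IH[OF \<delta>, of i] obtain N F
        where "prob (sym_diff (A i) {\<omega>\<in>space M. itin T Z N \<omega> \<in> F}) < \<delta>" by blast
      then show "\<exists>p. prob (sym_diff (A i) {\<omega>\<in>space M. itin T Z (fst p) \<omega> \<in> snd p}) < \<delta>"
        by (intro exI[of _ "(N, F)"]) simp
    qed
    from choice[OF this] obtain p
      where p: "\<forall>i. prob (sym_diff (A i) {\<omega>\<in>space M. itin T Z (fst (p i)) \<omega> \<in> snd (p i)}) < \<delta>" ..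
    define N F where "N i = fst (p i)" and "F i = snd (p i)" for i
    define B where "B i = {\<omega>\<in>space M. itin T Z (N i) \<omega> \<in> F i}" for i
    have NF: "prob (sym_diff (A i) (B i)) < \<delta>" for i using p by (simp add: B_def N_def F_def)
    have B: "B i \<in> events" for i unfolding B_def by (rule cyl)
    \<comment> \<open>\<open>m\<close> is at least every \<open>N i\<close>, so truncating a word of
      length \<open>m\<close> recovers all the shorter itineraries.\<close>
    define m where "m = (\<Sum>i<n. N i)"
    have m: "N i \<le> m" if "i < n" for i unfolding m_def using that by (intro member_le_sum) auto
    define G where "G = {l. \<exists>i<n. take (N i) l \<in> F i}"
    have G: "{\<omega>\<in>space M. itin T Z m \<omega> \<in> G} = (\<Union>i<n. B i)"
      using m by (auto simp: G_def B_def take_itin)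
    have "prob (sym_diff (\<Union>i. A i) (\<Union>i<n. B i)) \<le>
        prob (((\<Union>i. A i) - (\<Union>i<n. A i)) \<union> (\<Union>i<n. sym_diff (A i) (B i)))"
      using ev B by (intro finite_measure_mono) auto
    also have "\<dots> \<le> prob ((\<Union>i. A i) - (\<Union>i<n. A i)) + prob (\<Union>i<n. sym_diff (A i) (B i))"
      using ev B by (intro measure_Un_le) auto
    finally have 1: "prob (sym_diff (\<Union>i. A i) (\<Union>i<n. B i)) \<le>
        prob ((\<Union>i. A i) - (\<Union>i<n. A i)) + prob (\<Union>i<n. sym_diff (A i) (B i))" .
    have 2: "prob ((\<Union>i. A i) - (\<Union>i<n. A i)) < e / 2"
      using n ev by (subst finite_measure_Diff) auto
    have "prob (\<Union>i<n. sym_diff (A i) (B i)) \<le> (\<Sum>i<n. prob (sym_diff (A i) (B i)))"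
      using ev B by (intro finite_measure_subadditive_finite) auto
    also have "\<dots> \<le> (\<Sum>i<n. \<delta>)" using NF by (intro sum_mono less_imp_le)
    also have "\<dots> \<le> e / 2" using Union.prems by (simp add: \<delta>_def field_simps)
    finally have "prob (sym_diff (\<Union>i. A i) {\<omega>\<in>space M. itin T Z m \<omega> \<in> G}) < e"
      unfolding G using 1 2 by linarith
    then show ?case by blast
  qed
qed

text \<open>Induction on the family: each new set agrees, outside a set \<open>D\<close> of small
  probability, with an event readable off an itinerary, so it adds at most the entropy of the
  indicator of \<open>D\<close>. In terms of conditional entropy, a long itinerary leaves little
  uncertainty about \<alpha>.\<close>

lemma cond_ent_cell_le:
  assumes Z: "simple_function M Z"
    and gen: "events = sigma_sets (space M) {{\<omega>\<in>space M. Z ((T ^^ i) \<omega>) \<in> B} | i B. True}"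
    and \<alpha>: "finite \<alpha>" "\<alpha> \<subseteq> events" and e: "e > 0"
  shows "\<exists>N. ent M (\<lambda>\<omega>. (cell \<alpha> \<omega>, itin T Z N \<omega>)) \<le> ent M (itin T Z N) + e"
  using \<alpha> e
proof (induction \<alpha> arbitrary: e)
  case empty
  have "ent M (\<lambda>\<omega>. (cell {} \<omega>, itin T Z 0 \<omega>)) \<le> ent M (itin T Z 0)"
    by (rule ent_le_if_determined[OF simple_function_itin[OF Z]]) (simp add: cell_def)
  then show ?case using empty by (intro exI[of _ 0]) linarith
next
  case (insert A \<alpha>)
  let ?W = "itin T Z"
  note W = simple_function_itin[OF Z]
  have A: "A \<in> events" and \<alpha>: "\<alpha> \<subseteq> events" using insert by auto
  obtain N1 where N1: "ent M (\<lambda>\<omega>. (cell \<alpha> \<omega>, ?W N1 \<omega>)) \<le> ent M (?W N1) + e / 2"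
    using insert.IH[OF \<alpha>, of "e / 2"] insert.prems by auto
  \<comment> \<open>Provides \<open>p\<close> such that an event of probability at most
    \<open>p\<close> has entropy below \<open>e / 2\<close> by
    \<open>ent_indicator_le\<close>.\<close>
  have "((\<lambda>p. 2 * sqrt p + p) \<longlongrightarrow> 2 * sqrt 0 + 0) (at_right (0::real))"
    by (intro tendsto_intros)
  then have "\<forall>\<^sub>F p in at_right (0::real). 2 * sqrt p + p < e / 2"
    using insert.prems by (intro order_tendstoD(2)) auto
  then obtain p :: real where p: "p > 0" "2 * sqrt p + p < e / 2"
    using eventually_happens'[OF trivial_limit_at_right_real eventually_conj[OF eventually_at_right_less]]
    by blast
  obtain N2 F where NF: "prob (sym_diff A {\<omega>\<in>space M. ?W N2 \<omega> \<in> F}) < p"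
    using itin_approximation[OF Z gen A p(1)] by blast
  define D where "D = sym_diff A {\<omega>\<in>space M. ?W N2 \<omega> \<in> F}"
  have "{\<omega>\<in>space M. ?W N2 \<omega> \<in> F} \<in> events"
    using simple_functionD(2)[OF W, of N2 F] by (simp add: vimage_def Int_def conj_commute)
  then have D: "D \<in> events" unfolding D_def using A by auto
  have simple: "simple_function M (\<lambda>\<omega>. \<omega> \<in> B)" if "B \<in> events" for B
  proof (rule simple_function_determined)
    show "simple_function M (cell {B})" using that by (intro simple_function_cell) auto
  qed (auto simp: cell_def)
  define N where "N = max N1 N2"
  have le: "N1 \<le> N" "N2 \<le> N" by (auto simp: N_def)
  have det: "?W k \<omega> = ?W k \<omega>'" if "?W l \<omega> = ?W l \<omega>'" "k \<le> l" for k l \<omega> \<omega>'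
    using that by (simp add: itin_eq_iff)
  \<comment> \<open>Passing from \<open>N1\<close> to the longer length \<open>N\<close> does not
    increase the conditional entropy of the old cells.\<close>
  have 1: "ent M (\<lambda>\<omega>. (?W N \<omega>, cell \<alpha> \<omega>)) + ent M (?W N1) \<le>
      ent M (?W N) + ent M (\<lambda>\<omega>. (cell \<alpha> \<omega>, ?W N1 \<omega>))"
    using insert.hyps \<alpha> le det
    by (intro ent_submodular W simple_function_cell) blast+
  have "ent M (\<lambda>\<omega>. ((?W N \<omega>, cell \<alpha> \<omega>), \<omega> \<in> D)) \<le> ent M (\<lambda>\<omega>. (?W N \<omega>, cell \<alpha> \<omega>)) + ent M (\<lambda>\<omega>. \<omega> \<in> D)"
    using insert.hyps \<alpha> D by (intro ent_pair_le simple_function_Pair W simple_function_cell simple) auto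
  also have "ent M (\<lambda>\<omega>. \<omega> \<in> D) < e / 2"
    using ent_indicator_le[OF D, of p] NF p(2) by (simp add: D_def)
  finally have 2: "ent M (\<lambda>\<omega>. ((?W N \<omega>, cell \<alpha> \<omega>), \<omega> \<in> D)) < ent M (\<lambda>\<omega>. (?W N \<omega>, cell \<alpha> \<omega>)) + e / 2"
    by simp
  have "ent M (\<lambda>\<omega>. (cell (insert A \<alpha>) \<omega>, ?W N \<omega>)) \<le> ent M (\<lambda>\<omega>. ((?W N \<omega>, cell \<alpha> \<omega>), \<omega> \<in> D))"
  proof (rule ent_le_if_determined)
    show "simple_function M (\<lambda>\<omega>. ((?W N \<omega>, cell \<alpha> \<omega>), \<omega> \<in> D))"
      using insert.hyps \<alpha> D by (intro simple_function_Pair W simple_function_cell simple)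
    fix \<omega> \<omega>' assume \<omega>: "\<omega> \<in> space M" "\<omega>' \<in> space M"
      "((?W N \<omega>, cell \<alpha> \<omega>), \<omega> \<in> D) = ((?W N \<omega>', cell \<alpha> \<omega>'), \<omega>' \<in> D)"
    then have "?W N2 \<omega> = ?W N2 \<omega>'" using det le by blast
    \<comment> \<open>Within the space, \<open>A\<close> is the symmetric difference of
      \<open>D\<close> and an event read off the itinerary.\<close>
    with \<omega> have "\<omega> \<in> A \<longleftrightarrow> \<omega>' \<in> A" by (auto simp: D_def)
    moreover have "{B\<in>\<alpha>. \<omega> \<in> B} = {B\<in>\<alpha>. \<omega>' \<in> B}" using \<omega> by (simp add: cell_def)
    ultimately have "cell (insert A \<alpha>) \<omega> = cell (insert A \<alpha>) \<omega>'" unfolding cell_def by blast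
    with \<omega> show "(cell (insert A \<alpha>) \<omega>, ?W N \<omega>) = (cell (insert A \<alpha>) \<omega>', ?W N \<omega>')" by simp
  qed
  with 1 2 N1 have "ent M (\<lambda>\<omega>. (cell (insert A \<alpha>) \<omega>, ?W N \<omega>)) \<le> ent M (?W N) + e"
    by (simp add: field_simps)
  then show ?case by blast
qed

text \<open>Given the past, the next symbol costs at most H(R), and by
  \<open>cond_ent_cell_le\<close> the next cell of \<alpha> costs at most any prescribed
  \<open>e > 0\<close>. The joint entropy therefore grows by at most \<open>c + e\<close> per time
  step.\<close>

theorem ks_entropy_le:
  assumes Z: "simple_function M Z"
    and gen: "events = sigma_sets (space M) {{\<omega>\<in>space M. Z ((T ^^ i) \<omega>) \<in> B} | i B. True}"
    and R: "simple_function M R" "ent M R \<le> c"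
    and det: "\<And>\<omega> \<omega>'. \<omega> \<in> space M \<Longrightarrow> \<omega>' \<in> space M \<Longrightarrow> Z \<omega> = Z \<omega>' \<Longrightarrow> R \<omega> = R \<omega>' \<Longrightarrow>
      Z (T \<omega>) = Z (T \<omega>')"
  shows "ks_entropy M T \<le> ereal c"
  unfolding ks_entropy_def
proof (rule SUP_least)
  fix \<alpha> assume "\<alpha> \<in> {\<alpha>. fin_partition M \<alpha>}"
  then have \<alpha>: "fin_partition M \<alpha>" "finite \<alpha>" "\<alpha> \<subseteq> events" by (auto simp: fin_partition_def)
  let ?W = "itin T Z" and ?G = "itin T (cell \<alpha>)"
  note W = simple_function_itin[OF Z] and g = simple_function_cell[OF \<alpha>(2,3)]
  note G = simple_function_itin[OF g]
  have "entropy_wrt M T \<alpha> \<le> c + e" if e: "e > 0" for e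
  proof -
    obtain N where N: "ent M (\<lambda>\<omega>. (cell \<alpha> \<omega>, ?W N \<omega>)) \<le> ent M (?W N) + e"
      using cond_ent_cell_le[OF Z gen \<alpha>(2,3) e] by blast
    \<comment> \<open>The symbols run up to time \<open>n + N\<close> inclusive: the
      \<open>N\<close> of them from time \<open>n\<close> on predict the cell at time
      \<open>n\<close>, and the one at time \<open>n + N\<close> is the present symbol for
      \<open>R\<close>.\<close>
    define E where "E n = ent M (\<lambda>\<omega>. (?W (Suc (n + N)) \<omega>, ?G n \<omega>))" for n
    have step: "E (Suc n) \<le> E n + (c + e)" for n
    proof -
      define U where "U = (\<lambda>\<omega>. (?W (Suc (n + N)) \<omega>, ?G n \<omega>))"
      have U: "simple_function M U" unfolding U_def by (intro simple_function_Pair W G)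
      define V where "V = (\<lambda>\<omega>. cell \<alpha> ((T ^^ n) \<omega>))"
      have V: "simple_function M V" unfolding V_def by (rule simple_function_T_pow[OF g])
      define S where "S = (\<lambda>\<omega>. R ((T ^^ (n + N)) \<omega>))"
      have S: "simple_function M S" unfolding S_def by (rule simple_function_T_pow[OF R(1)])
      \<comment> \<open>The cell at time \<open>n\<close> costs at most \<open>e\<close>:
        \<open>U\<close> contains the \<open>N\<close> symbols from time \<open>n\<close> on, and
        invariance carries the estimate from time 0 to time \<open>n\<close>.\<close>
      have "ent M (\<lambda>\<omega>. (U \<omega>, V \<omega>)) + ent M (\<lambda>\<omega>. ?W N ((T ^^ n) \<omega>)) \<le>
          ent M U + ent M (\<lambda>\<omega>. (V \<omega>, ?W N ((T ^^ n) \<omega>)))"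
      proof (rule ent_submodular[OF U V])
        fix \<omega> \<omega>' assume "U \<omega> = U \<omega>'"
        then have *: "\<forall>i<Suc (n + N). Z ((T ^^ i) \<omega>) = Z ((T ^^ i) \<omega>')"
          by (simp add: U_def itin_eq_iff)
        have "Z ((T ^^ i) ((T ^^ n) \<omega>)) = Z ((T ^^ i) ((T ^^ n) \<omega>'))" if "i < N" for i
          using *[rule_format, of "i + n"] that by (simp add: funpow_add)
        then show "?W N ((T ^^ n) \<omega>) = ?W N ((T ^^ n) \<omega>')" by (simp add: itin_eq_iff)
      qed
      moreover have "ent M (\<lambda>\<omega>. ?W N ((T ^^ n) \<omega>)) = ent M (?W N)" by (rule ent_T_pow[OF W])
      moreover have "ent M (\<lambda>\<omega>. (V \<omega>, ?W N ((T ^^ n) \<omega>))) = ent M (\<lambda>\<omega>. (cell \<alpha> \<omega>, ?W N \<omega>))"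
        using ent_T_pow[OF simple_function_Pair[OF g W]] by (simp add: V_def)
      ultimately have 1: "ent M (\<lambda>\<omega>. (U \<omega>, V \<omega>)) \<le> ent M U + e" using N by linarith
      have 2: "ent M (\<lambda>\<omega>. ((U \<omega>, V \<omega>), S \<omega>)) \<le> ent M (\<lambda>\<omega>. (U \<omega>, V \<omega>)) + ent M S"
        by (intro ent_pair_le simple_function_Pair U V S)
      have "ent M S = ent M R" unfolding S_def by (rule ent_T_pow[OF R(1)])
      moreover have "E (Suc n) \<le> ent M (\<lambda>\<omega>. ((U \<omega>, V \<omega>), S \<omega>))"
        unfolding E_def
      proof (rule ent_le_if_determined)
        show "simple_function M (\<lambda>\<omega>. ((U \<omega>, V \<omega>), S \<omega>))"
          by (intro simple_function_Pair U V S)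
        fix \<omega> \<omega>' assume \<omega>: "\<omega> \<in> space M" "\<omega>' \<in> space M"
          and eq: "((U \<omega>, V \<omega>), S \<omega>) = ((U \<omega>', V \<omega>'), S \<omega>')"
        have Weq: "\<forall>i<Suc (n + N). Z ((T ^^ i) \<omega>) = Z ((T ^^ i) \<omega>')"
          using eq by (simp add: U_def itin_eq_iff)
        \<comment> \<open>\<open>det\<close> at time \<open>n + N\<close> yields the one missing
          symbol, that of time \<open>n + N + 1\<close>.\<close>
        then have "Z (T ((T ^^ (n + N)) \<omega>)) = Z (T ((T ^^ (n + N)) \<omega>'))"
          using eq by (intro det T_pow_space \<omega>) (auto simp: S_def)
        with Weq have "?W (Suc (Suc n + N)) \<omega> = ?W (Suc (Suc n + N)) \<omega>'"
          by (simp add: itin_eq_iff less_Suc_eq)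
        moreover have "?G (Suc n) \<omega> = ?G (Suc n) \<omega>'"
          using eq by (simp add: U_def V_def itin_eq_iff less_Suc_eq)
        ultimately show "(?W (Suc (Suc n + N)) \<omega>, ?G (Suc n) \<omega>) =
            (?W (Suc (Suc n + N)) \<omega>', ?G (Suc n) \<omega>')" by simp
      qed
      ultimately show ?thesis using 1 2 R(2) by (simp add: E_def U_def)
    qed
    have E: "E n \<le> E 0 + real n * (c + e)" for n
    proof (induction n)
      case (Suc n)
      then show ?case using step[of n] by (simp add: algebra_simps)
    qed simp
    have bound: "ent M (?G n) / real n \<le> E 0 / real n + (c + e)" if "n \<ge> 1" for n
    proof -
      have "ent M (?G n) \<le> E n" unfolding E_def
        by (rule ent_le_if_determined[OF simple_function_Pair[OF W G]]) simp
      with E[of n] have "ent M (?G n) / real n \<le> (E 0 + real n * (c + e)) / real n"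
        by (intro divide_right_mono) auto
      also have "\<dots> = E 0 / real n + (c + e)" using that by (simp add: add_divide_distrib)
      finally show ?thesis .
    qed
    have "(\<lambda>n. E 0 / real n + (c + e)) \<longlonglongrightarrow> 0 + (c + e)"
      by (intro tendsto_intros tendsto_divide_0[OF tendsto_const] filterlim_real_sequentially
          filterlim_at_top_imp_at_infinity)
    then show ?thesis
      using bound by (intro LIMSEQ_le[OF entropy_wrt_limit[OF \<alpha>(1)]]) auto
  qed
  then show "ereal (entropy_wrt M T \<alpha>) \<le> ereal c" by (simp add: field_le_epsilon)
qed

end

section \<open>Invariant measures of the shift\<close>

lemma space_borel_X [simp]: "space borel_X = X"
  by (simp add: borel_X_def space_restrict_space)

text \<open>The Borel sets of a countable product of second countable spaces are generated by
  one-coordinate cylinders, and restriction to \<open>X\<close> takes traces of the generators.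
  Hence the first coordinate is a generator for the shift.\<close>

lemma sets_borel_X: "sets borel_X = sigma_sets X {{\<xi>\<in>X. \<xi> i \<in> B} | i B. True}"
proof -
  let ?G = "{{f. f i \<in> B} | i B. True} :: (nat \<Rightarrow> nat) set set"
  have nat: "B \<in> sets borel" for B :: "nat set" by (rule borel_open) (rule discrete_topology_class.open_discrete)
  have "sets (borel :: (nat \<Rightarrow> nat) measure) = sigma_sets UNIV ?G"
    using sets_PiM_single[of UNIV "\<lambda>_::nat. borel :: nat measure"] nat
    by (simp add: sets_PiM_equal_borel PiE_UNIV_domain)
  \<comment> \<open>\<open>id\<close> serves as the inclusion of \<open>X\<close>: taking traces is
    then a preimage, which commutes with generating a sigma-algebra.\<close>
  then have "sets borel_X = {id -` A \<inter> X | A. A \<in> sigma_sets UNIV ?G}"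
    by (auto simp: borel_X_def sets_restrict_space)
  also have "\<dots> = sigma_sets X {id -` A \<inter> X | A. A \<in> ?G}"
    by (rule sigma_sets_vimage_commute) auto
  also have "{id -` A \<inter> X | A. A \<in> ?G} = {{\<xi>\<in>X. \<xi> i \<in> B} | i B. True}"
  proof -
    have eq: "id -` {f. f i \<in> B} \<inter> X = {\<xi>\<in>X. \<xi> i \<in> B}" for i B by auto
    show ?thesis
    proof (intro equalityI subsetI)
      fix A assume "A \<in> {id -` A \<inter> X | A. A \<in> ?G}"
      then obtain i B where "A = id -` {f. f i \<in> B} \<inter> X" by blast
      then show "A \<in> {{\<xi>\<in>X. \<xi> i \<in> B} | i B. True}" unfolding eq by blast
    next
      fix A assume "A \<in> {{\<xi>\<in>X. \<xi> i \<in> B} | i B. True}"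
      then obtain i B where "A = id -` {f. f i \<in> B} \<inter> X" unfolding eq by blast
      then show "A \<in> {id -` A \<inter> X | A. A \<in> ?G}" by blast
    qed
  qed
  finally show ?thesis .
qed

lemma cyl_set_borel_X: "{\<xi>\<in>X. \<xi> i \<in> B} \<in> sets borel_X"
  unfolding sets_borel_X by (rule sigma_sets.Basic) blast

lemma measurable_coord: "(\<lambda>\<xi>. \<xi> i) \<in> measurable borel_X (count_space UNIV)"
  using cyl_set_borel_X[of i] by (auto intro!: measurableI simp: vimage_def Int_def conj_commute)

lemma measurable_into_borel_X:
  assumes "\<And>\<omega>. \<omega> \<in> space M \<Longrightarrow> h \<omega> \<in> X" and "\<And>i. (\<lambda>\<omega>. h \<omega> i) \<in> measurable M (count_space UNIV)"
  shows "h \<in> measurable M borel_X"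
  unfolding borel_X_def
proof (rule measurable_restrict_space2)
  have "(\<lambda>\<omega>. h \<omega> i) \<in> borel_measurable M" for i
    using measurable_compose[OF assms(2)[of i], of id borel] by simp
  then show "h \<in> borel_measurable M" by (rule measurable_coordinatewise_then_product)
qed (use assms(1) in auto)

lemma X_values: "\<xi> \<in> X \<Longrightarrow> \<xi> i \<in> {0, 1, 2, 3}"
  unfolding X_def by blast

lemma shift_X: "\<xi> \<in> X \<Longrightarrow> shift \<xi> \<in> X"
  by (simp add: X_def shift_def)

lemma shift_pow: "(shift ^^ n) \<xi> = (\<lambda>i. \<xi> (n + i))"
  by (induction n arbitrary: \<xi>) (simp_all add: shift_def)

lemma measurable_shift: "shift \<in> measurable borel_X borel_X"
proof (rule measurable_into_borel_X)
  show "(\<lambda>\<xi>. shift \<xi> i) \<in> measurable borel_X (count_space UNIV)" for i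
    using measurable_coord[of "Suc i"] by (simp add: shift_def)
qed (simp add: shift_X)

text \<open>Membership in a singleton, rather than an equation, makes the blocks instances of
  \<open>cyl_set_borel_X\<close>.\<close>

definition first_partition :: "(nat \<Rightarrow> nat) set set" where
  "first_partition = (\<lambda>s. {\<xi>\<in>X. \<xi> 0 \<in> {s}}) ` {0, 1, 2, 3}"

lemma first_cell: "\<xi> \<in> X \<Longrightarrow> {\<zeta>\<in>X. \<zeta> 0 \<in> {\<xi> 0}} \<in> first_partition"
  unfolding first_partition_def by (intro imageI X_values)

locale invariant_measure =
  fixes \<mu> :: "(nat \<Rightarrow> nat) measure"
  assumes invariant: "\<mu> \<in> invariant_measures"
begin

lemma sets_\<mu>: "sets \<mu> = sets borel_X" and distr_\<mu>: "distr \<mu> \<mu> shift = \<mu>"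
  using invariant by (auto simp: invariant_measures_def)

lemma space_\<mu> [simp]: "space \<mu> = X"
  using sets_eq_imp_space_eq[OF sets_\<mu>] by simp

sublocale measure_preserving_system \<mu> shift
proof -
  interpret prob_space \<mu> using invariant by (simp add: invariant_measures_def)
  show "measure_preserving_system \<mu> shift"
    using measurable_shift distr_\<mu>
    by unfold_locales (simp_all add: measurable_cong_sets[OF sets_\<mu> sets_\<mu>])
qed

lemma prob_X [simp]: "prob X = 1"
  using prob_space by simp

lemma simple_first: "simple_function \<mu> (\<lambda>\<xi>. \<xi> 0)"
  unfolding simple_function_def
proof (intro conjI ballI)
  show "finite ((\<lambda>\<xi>. \<xi> 0) ` space \<mu>)"
    unfolding space_\<mu> by (rule finite_subset[OF image_subsetI[OF X_values]]) simp_all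
  show "(\<lambda>\<xi>. \<xi> 0) -` {v} \<inter> space \<mu> \<in> events" for v
    using cyl_set_borel_X[of 0 "{v}"] by (simp add: sets_\<mu> vimage_def Int_def conj_commute)
qed

text \<open>A function of finitely many coordinates is a function of a finite itinerary of the first
  coordinate.\<close>

lemma simple_function_local:
  assumes "\<And>\<xi> \<zeta>. \<xi> \<in> X \<Longrightarrow> \<zeta> \<in> X \<Longrightarrow> (\<forall>i<n. \<xi> i = \<zeta> i) \<Longrightarrow> g \<xi> = g \<zeta>"
  shows "simple_function \<mu> g"
proof (rule simple_function_determined[OF simple_function_itin[OF simple_first, of n]])
  fix \<xi> \<zeta> assume "\<xi> \<in> space \<mu>" "\<zeta> \<in> space \<mu>"
    "itin shift (\<lambda>\<xi>. \<xi> 0) n \<xi> = itin shift (\<lambda>\<xi>. \<xi> 0) n \<zeta>"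
  then show "g \<xi> = g \<zeta>" by (intro assms) (simp_all add: itin_eq_iff shift_pow)
qed

lemma ks_entropy_shift_le:
  assumes R: "simple_function \<mu> R" "ent \<mu> R \<le> c"
    and det: "\<And>\<xi> \<zeta>. \<xi> \<in> X \<Longrightarrow> \<zeta> \<in> X \<Longrightarrow> \<xi> 0 = \<zeta> 0 \<Longrightarrow> R \<xi> = R \<zeta> \<Longrightarrow> \<xi> 1 = \<zeta> 1"
  shows "ks_entropy \<mu> shift \<le> ereal c"
proof (rule ks_entropy_le[OF simple_first _ R])
  show "events = sigma_sets (space \<mu>) {{\<xi>\<in>space \<mu>. (shift ^^ i) \<xi> 0 \<in> B} | i B. True}"
    by (simp add: sets_\<mu> sets_borel_X shift_pow)
  show "shift \<xi> 0 = shift \<zeta> 0" if "\<xi> \<in> space \<mu>" "\<zeta> \<in> space \<mu>" "\<xi> 0 = \<zeta> 0" "R \<xi> = R \<zeta>" for \<xi> \<zeta>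
    using det[of \<xi> \<zeta>] that by (simp add: shift_def)
qed

text \<open>Take the second symbol itself as the extra information \<open>R\<close>: by invariance
  it has the entropy of the first symbol, which is 0.\<close>

lemma ks_entropy_eq_0_if_AE_first:
  assumes "AE \<xi> in \<mu>. \<xi> 0 = c"
  shows "ks_entropy \<mu> shift = 0"
proof -
  have s: "simple_function \<mu> (\<lambda>\<xi>. \<xi> 1)"
    by (rule simple_function_local[of 2]) simp
  have "ent \<mu> (\<lambda>\<xi>. \<xi> 1) = ent \<mu> (\<lambda>\<xi>. (shift ^^ 1) \<xi> 0)"
    by (rule ent_cong) (simp add: shift_def)
  also have "\<dots> = ent \<mu> (\<lambda>\<xi>. \<xi> 0)" by (rule ent_T_pow[OF simple_first])
  also have "\<dots> = 0" by (rule ent_AE_const[OF simple_first assms])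
  finally have "ks_entropy \<mu> shift \<le> ereal 0"
    by (intro ks_entropy_shift_le[OF s]) auto
  then show ?thesis using ks_entropy_nonneg by (simp add: zero_ereal_def antisym)
qed

lemma fin_partition_first: "fin_partition \<mu> first_partition"
proof -
  have ne: "\<exists>\<xi>\<in>X. \<xi> 0 = s" if "s \<in> {0, 1, 2, 3}" for s :: nat
    using that by (intro bexI[of _ "\<lambda>_. s"]) (auto simp: X_def)
  have "partition_on X first_partition"
  proof (rule partition_onI)
    show "\<Union> first_partition = X"
    proof (intro equalityI subsetI)
      fix \<xi> assume "\<xi> \<in> X"
      then show "\<xi> \<in> \<Union> first_partition" by (intro UnionI[OF first_cell]) auto
    qed (auto simp: first_partition_def)
    show "{} \<notin> first_partition"
    proof
      assume "{} \<in> first_partition"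
      then obtain s where s: "{} = {\<xi>\<in>X. \<xi> 0 \<in> {s}}" "s \<in> {0, 1, 2, 3}"
        unfolding first_partition_def by (rule imageE)
      from ne[OF s(2)] s(1) show False by blast
    qed
    show "disjnt p q" if pq: "p \<in> first_partition" "q \<in> first_partition" "p \<noteq> q" for p q
    proof -
      obtain s where s: "p = {\<xi>\<in>X. \<xi> 0 \<in> {s}}"
        using pq(1) unfolding first_partition_def by blast
      obtain t where t: "q = {\<xi>\<in>X. \<xi> 0 \<in> {t}}"
        using pq(2) unfolding first_partition_def by blast
      from pq(3) show ?thesis unfolding s t by (auto simp: disjnt_def)
    qed
  qed
  moreover have "first_partition \<subseteq> events"
    unfolding first_partition_def sets_\<mu> by (intro image_subsetI cyl_set_borel_X)
  ultimately show ?thesis by (simp add: fin_partition_def first_partition_def)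
qed

text \<open>The partition by the first symbol competes in the supremum, and its itineraries
  determine the words of the point.\<close>

lemma ks_entropy_ge:
  assumes "\<And>n. n \<ge> 1 \<Longrightarrow> real n * c \<le> ent \<mu> (itin shift (\<lambda>\<xi>. \<xi> 0) n)"
  shows "ereal c \<le> ks_entropy \<mu> shift"
proof -
  let ?\<alpha> = first_partition
  have \<alpha>: "fin_partition \<mu> ?\<alpha>" by (rule fin_partition_first)
  then have s: "simple_function \<mu> (cell ?\<alpha>)"
    by (auto simp: fin_partition_def simple_function_cell)
  have "c \<le> ent \<mu> (itin shift (cell ?\<alpha>) n) / real n" if "n \<ge> 1" for n
  proof -
    have "ent \<mu> (itin shift (\<lambda>\<xi>. \<xi> 0) n) \<le> ent \<mu> (itin shift (cell ?\<alpha>) n)"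
    proof (rule ent_le_if_determined[OF simple_function_itin[OF s]])
      fix \<xi> \<zeta> assume \<xi>: "\<xi> \<in> space \<mu>" "\<zeta> \<in> space \<mu>"
        "itin shift (cell ?\<alpha>) n \<xi> = itin shift (cell ?\<alpha>) n \<zeta>"
      have "\<xi>' 0 = \<zeta>' 0" if "cell ?\<alpha> \<xi>' = cell ?\<alpha> \<zeta>'" "\<xi>' \<in> X" for \<xi>' \<zeta>'
      proof -
        have "{\<xi>\<in>X. \<xi> 0 \<in> {\<xi>' 0}} \<in> cell ?\<alpha> \<xi>'"
          using first_cell[OF that(2)] that(2) by (simp add: cell_def)
        then have "{\<xi>\<in>X. \<xi> 0 \<in> {\<xi>' 0}} \<in> cell ?\<alpha> \<zeta>'" using that(1) by simp
        then show ?thesis by (simp add: cell_def)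
      qed
      then show "itin shift (\<lambda>\<xi>. \<xi> 0) n \<xi> = itin shift (\<lambda>\<xi>. \<xi> 0) n \<zeta>"
        using \<xi> T_pow_space[of \<xi>] unfolding itin_eq_iff by simp
    qed
    with assms[OF that] have "real n * c \<le> ent \<mu> (itin shift (cell ?\<alpha>) n)" by linarith
    then show ?thesis using that by (simp add: field_simps)
  qed
  then have "c \<le> entropy_wrt \<mu> shift ?\<alpha>"
    using LIMSEQ_le[OF tendsto_const entropy_wrt_limit[OF \<alpha>], of c] by auto
  then have "ereal c \<le> ereal (entropy_wrt \<mu> shift ?\<alpha>)" by simp
  also have "\<dots> \<le> ks_entropy \<mu> shift"
    unfolding ks_entropy_def using \<alpha> by (intro SUP_upper) simp
  finally show ?thesis .
qed

end

section \<open>The point mass at a fixed point and the coin-tossing measure\<close>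

lemma dirac_invariant: "return borel_X ptx \<in> invariant_measures"
proof -
  have X: "ptx \<in> X" by (simp add: X_def ptx_def)
  have "shift ptx = ptx" by (simp add: shift_def ptx_def)
  then have "distr (return borel_X ptx) borel_X shift = return borel_X ptx"
    using X by (simp add: distr_return[OF measurable_shift])
  moreover have "distr (return borel_X ptx) (return borel_X ptx) shift = distr (return borel_X ptx) borel_X shift"
    by (rule distr_cong) auto
  ultimately show ?thesis using X by (simp add: invariant_measures_def prob_space_return)
qed

text \<open>The space of a \<open>pmf\<close> is its whole type, so the sample space here is all of
  \<open>nat \<Rightarrow> nat\<close> and contains points outside \<open>X\<close>.\<close>

definition coin_base :: "(nat \<Rightarrow> nat) measure" where
  "coin_base = PiM UNIV (\<lambda>_. measure_pmf (pmf_of_set {0, 1}))"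

text \<open>Reducing mod 2 puts every point, not only almost every point, of the coded space into
  $\{0,1\}^{\mathbb N}$.\<close>
definition coin_code :: "(nat \<Rightarrow> nat) \<Rightarrow> nat \<Rightarrow> nat" where
  "coin_code \<omega> = (\<lambda>i. \<omega> i mod 2)"

definition coin :: "(nat \<Rightarrow> nat) measure" where
  "coin = distr coin_base borel_X coin_code"

interpretation coin_base: product_prob_space "\<lambda>_::nat. measure_pmf (pmf_of_set {0, 1::nat})" UNIV
  by unfold_locales

interpretation coin_prob: prob_space coin_base
  unfolding coin_base_def by unfold_locales

lemma space_coin_base [simp]: "space coin_base = UNIV"
  by (simp add: coin_base_def space_PiM)

lemma prob_coin_base_UNIV [simp]: "measure coin_base UNIV = 1"
  using coin_prob.prob_space by simp

lemma coin_code_01: "coin_code \<omega> i \<in> {0, 1}"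
  by (auto simp: coin_code_def)

lemma coin_code_X: "coin_code \<omega> \<in> X"
  using coin_code_01[of \<omega>] unfolding X_def by blast

lemma measurable_coin_base_coord: "(\<lambda>\<omega>. \<omega> i) \<in> measurable coin_base (count_space UNIV)"
proof -
  have "(\<lambda>\<omega>. \<omega> i) \<in> measurable coin_base (measure_pmf (pmf_of_set {0, 1}))"
    unfolding coin_base_def by (rule measurable_component_singleton) simp
  then show ?thesis by (simp only: measurable_pmf_measure2)
qed

lemma measurable_coin_code: "coin_code \<in> measurable coin_base borel_X"
proof (rule measurable_into_borel_X)
  show "(\<lambda>\<omega>. coin_code \<omega> i) \<in> measurable coin_base (count_space UNIV)" for i
    unfolding coin_code_def by (rule measurable_compose[OF measurable_coin_base_coord]) simp
qed (rule coin_code_X)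

text \<open>It suffices to compare finite boxes: the shift pulls a box over \<open>J\<close> back to
  a box over \<open>Suc\<close> followed by the image of \<open>J\<close>, with the same
  factors.\<close>

lemma distr_coin_base_shift: "distr coin_base coin_base shift = coin_base"
  unfolding coin_base_def
proof (rule coin_base.PiM_eq)
  let ?M = "\<lambda>_::nat. measure_pmf (pmf_of_set {0, 1::nat})"
  fix J :: "nat set" and F :: "nat \<Rightarrow> nat set"
  assume J: "finite J"
  have meas: "shift \<in> measurable (PiM UNIV ?M) (PiM UNIV ?M)"
    unfolding shift_def by (rule measurable_PiM_single') auto
  have "emeasure (distr (PiM UNIV ?M) (PiM UNIV ?M) shift) (prod_emb UNIV ?M J (Pi\<^sub>E J F)) =
      emeasure (PiM UNIV ?M) (shift -` prod_emb UNIV ?M J (Pi\<^sub>E J F) \<inter> space (PiM UNIV ?M))"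
    using J by (intro emeasure_distr meas sets_PiM_I) auto
  also have "shift -` prod_emb UNIV ?M J (Pi\<^sub>E J F) \<inter> space (PiM UNIV ?M) =
      prod_emb UNIV ?M (Suc ` J) (Pi\<^sub>E (Suc ` J) (\<lambda>i. F (i - 1)))"
    by (auto simp: prod_emb_def space_PiM shift_def PiE_iff)
  also have "emeasure (PiM UNIV ?M) \<dots> = (\<Prod>i\<in>Suc ` J. emeasure (measure_pmf (pmf_of_set {0, 1})) (F (i - 1)))"
    using J by (intro coin_base.emeasure_PiM_emb) auto
  also have "\<dots> = (\<Prod>j\<in>J. emeasure (measure_pmf (pmf_of_set {0, 1})) (F j))"
    by (subst prod.reindex) auto
  finally show "emeasure (distr (PiM UNIV ?M) (PiM UNIV ?M) shift) (prod_emb UNIV ?M J (Pi\<^sub>E J F)) =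
      (\<Prod>j\<in>J. emeasure (measure_pmf (pmf_of_set {0, 1})) (F j))" .
qed simp

text \<open>Coding commutes with the shift, so invariance passes from the product measure to its
  image.\<close>

lemma coin_invariant: "coin \<in> invariant_measures"
proof -
  have sh: "shift \<in> measurable coin_base coin_base"
    unfolding coin_base_def shift_def by (rule measurable_PiM_single') auto
  have "distr coin coin shift = distr coin borel_X shift" by (rule distr_cong) (auto simp: coin_def)
  also have "\<dots> = distr coin_base borel_X (shift \<circ> coin_code)"
    unfolding coin_def by (rule distr_distr[OF measurable_shift measurable_coin_code])
  also have "shift \<circ> coin_code = coin_code \<circ> shift"
    by (simp add: fun_eq_iff shift_def coin_code_def)
  also have "distr coin_base borel_X (coin_code \<circ> shift) = distr (distr coin_base coin_base shift) borel_X coin_code"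
    by (rule distr_distr[OF measurable_coin_code sh, symmetric])
  also have "\<dots> = coin" by (simp add: distr_coin_base_shift coin_def)
  finally show ?thesis
    using coin_prob.prob_space_distr[OF measurable_coin_code]
    by (simp add: invariant_measures_def coin_def)
qed

interpretation coin: invariant_measure coin
  by unfold_locales (rule coin_invariant)

text \<open>The coding pulls the cylinder back to a box of independent coordinates, each of mass 1/2
  if the letter is 0 or 1 and of mass 0 otherwise.\<close>

lemma measure_coin_word:
  "measure coin {\<xi>\<in>X. \<forall>i<n. \<xi> i = w i} \<in> {0, (1 / 2) ^ n}"
proof -
  let ?M = "\<lambda>_::nat. measure_pmf (pmf_of_set {0, 1::nat})"
  let ?A = "{\<xi>\<in>X. \<forall>i<n. \<xi> i = w i}"
  have "?A = X \<inter> (\<Inter>i<n. {\<xi>\<in>X. \<xi> i \<in> {w i}})" by auto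
  also have "\<dots> \<in> sets borel_X"
  proof (cases "n = 0")
    case False
    then have "(\<Inter>i<n. {\<xi>\<in>X. \<xi> i \<in> {w i}}) \<in> sets borel_X"
      by (intro sets.finite_INT cyl_set_borel_X) auto
    then show ?thesis using sets.top[of borel_X] by (intro sets.Int) simp_all
  qed (use sets.top[of borel_X] in simp)
  finally have A: "?A \<in> sets borel_X" .
  have "measure coin ?A = measure coin_base (coin_code -` ?A \<inter> space coin_base)"
    unfolding coin_def by (rule measure_distr[OF measurable_coin_code A])
  also have "coin_code -` ?A \<inter> space coin_base = prod_emb UNIV ?M {..<n} (Pi\<^sub>E {..<n} (\<lambda>i. {v. v mod 2 = w i}))"
    using coin_code_X by (auto simp: prod_emb_def PiE_iff coin_code_def)
  also have "measure coin_base \<dots> = (\<Prod>i<n. measure (measure_pmf (pmf_of_set {0, 1})) {v. v mod 2 = w i})"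
    unfolding coin_base_def by (rule coin_base.measure_PiM_emb) auto
  finally have eq: "measure coin ?A = (\<Prod>i<n. measure (measure_pmf (pmf_of_set {0, 1})) {v. v mod 2 = w i})" .
  have half: "measure (measure_pmf (pmf_of_set {0, 1})) {v. v mod 2 = c} = (if c \<in> {0, 1} then 1 / 2 else 0)"
    for c :: nat
  proof -
    have "{0, 1} \<inter> {v. v mod 2 = c} = (if c \<in> {0, 1} then {c} else {})" by auto
    then show ?thesis by (simp add: measure_pmf_of_set)
  qed
  show ?thesis
  proof (cases "\<forall>i<n. w i \<in> {0, 1}")
    case True
    then have "measure coin ?A = (\<Prod>i<n. 1 / 2)" unfolding eq half by (intro prod.cong) auto
    then show ?thesis by simp
  next
    case False
    then have "measure coin ?A = 0" unfolding eq half by (intro prod_zero) auto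
    then show ?thesis by simp
  qed
qed

lemma ks_entropy_coin: "ereal (ln 2) \<le> ks_entropy coin shift"
proof (rule coin.ks_entropy_ge)
  fix n :: nat
  let ?W = "itin shift (\<lambda>\<xi>. \<xi> 0) n"
  let ?p = "\<lambda>v. measure coin (?W -` {v} \<inter> space coin)"
  have s: "simple_function coin ?W" by (rule coin.simple_function_itin[OF coin.simple_first])
  \<comment> \<open>Linear in the probability on both possible values: for 0 both sides vanish, and
    otherwise the logarithm is -n ln 2. The total mass 1 then gives the entropy.\<close>
  have "?p v * ln (?p v) = - (real n * ln 2) * ?p v" if v: "v \<in> ?W ` space coin" for v
  proof -
    have "?W -` {v} \<inter> space coin = {\<xi>\<in>X. \<forall>i<n. \<xi> i = v ! i}"
      using v by (auto simp: list_eq_iff_nth_eq shift_pow)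
    then have "?p v \<in> {0, (1 / 2) ^ n}" by (simp only: measure_coin_word)
    then show ?thesis by (auto simp: ln_realpow ln_div)
  qed
  then have "ent coin ?W = real n * ln 2 * (\<Sum>v\<in>?W ` space coin. ?p v)"
    by (simp add: ent_def sum_distrib_left sum_negf)
  also have "(\<Sum>v\<in>?W ` space coin. ?p v) = 1"
    by (rule coin.simple_distributed_sum_space[OF coin.simple_distributedI[OF s measure_nonneg refl]])
  finally show "real n * ln 2 \<le> ent coin ?W" by simp
qed

section \<open>The approximating potentials\<close>

text \<open>One approximating potential, at a fixed \<open>K\<close>. \<open>lam \<ge> 2\<close>
  puts the first two symbols within the range that \<open>Y0 lam\<close> inspects;
  \<open>l1_pos\<close> is derived from strict concavity in the final theorem.\<close>

locale approximation =
  fixes a :: real and l1 :: "real \<Rightarrow> real" and x :: "nat \<Rightarrow> real" and lam K :: nat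
  assumes x_range: "\<And>k. k \<ge> 1 \<Longrightarrow> x k \<in> {0<..<a}"
    and x_Suc: "\<And>k. k \<ge> 1 \<Longrightarrow> x (Suc k) < x k"
    and lam: "lam \<ge> 2" and K: "K \<ge> lam"
    and l1_pos: "\<And>t. t \<in> {0<..<a} \<Longrightarrow> l1 t > 0"
begin

abbreviation Psi :: "(nat \<Rightarrow> nat) \<Rightarrow> real \<times> real" where
  "Psi \<equiv> Phi_eps a l1 x lam K"

definition d :: real where "d = x (K + 1 - lam)"

lemma d_range: "d \<in> {0<..<a}"
  unfolding d_def using K by (intro x_range) simp

lemma a_pos: "a > 0"
  using d_range by simp

lemma x_strict_antimono: "1 \<le> j \<Longrightarrow> j < k \<Longrightarrow> x k < x j"
proof (induction k)
  case (Suc k)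
  show ?case
  proof (cases "j = k")
    case False
    with Suc show ?thesis using x_Suc[of k] by fastforce
  qed (use Suc x_Suc in auto)
qed simp

text \<open>Sorted by the first change between the classes \<open>S1\<close> and \<open>S2\<close>:
  among the first \<open>lam\<close> symbols, at the \<open>k\<close>-th symbol with k in between,
  or not among the first \<open>K\<close> symbols.\<close>

lemma point_cases:
  assumes "\<xi> \<in> X"
  obtains (Y0) "\<xi> \<in> Y0 lam"
    | (level) k where "lam < k" "k \<le> K" "\<xi> \<in> Y S1 k \<union> Y S2 k"
    | (deep) "\<xi> \<in> Ytilde S1 K \<union> Ytilde S2 K"
proof -
  have "\<xi> \<in> Xeps lam K \<union> Y0 lam \<union> (Ytilde S1 K \<union> Ytilde S2 K)"
    using assms Phi_eps_cover[OF K] by blast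
  then consider "\<xi> \<in> Xeps lam K" | "\<xi> \<in> Y0 lam" | "\<xi> \<in> Ytilde S1 K \<union> Ytilde S2 K" by blast
  then show thesis
  proof cases
    case 1
    then obtain k where "k \<in> {lam<..K}" "\<xi> \<in> Y S1 k \<union> Y S2 k"
      unfolding Xeps_def Xlev_def by blast
    then show thesis by (intro level) auto
  qed (use that in blast)+
qed

lemma Psi_Y0: "\<xi> \<in> Y0 lam \<Longrightarrow> Psi \<xi> = (a, 0)"
  using lam K by (simp add: Phi_eps_clauses(1) Phi_clauses(1))

lemma Psi_level:
  assumes k: "lam < k" "k \<le> K"
  shows "\<xi> \<in> Xlev k \<Longrightarrow> Psi \<xi> = (x (k - lam), 0)"
    and "\<xi> \<in> cyl (k - 1) ptx \<inter> Y S1 k \<Longrightarrow> Psi \<xi> = (x (k - lam), l1 (x (k - lam)))"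
    and "\<xi> \<in> cyl (k - 1) pty \<inter> Y S2 k \<Longrightarrow> Psi \<xi> = (x (k - lam), - l1 (x (k - lam)))"
proof -
  have lam1: "lam \<ge> 1" using lam by simp
  have eps: "Psi \<xi> = Phi a l1 x lam \<xi>"
    if "\<xi> \<in> Xlev k \<union> cyl (k - 1) ptx \<inter> Y S1 k \<union> cyl (k - 1) pty \<inter> Y S2 k"
  proof (rule Phi_eps_clauses(1)[OF lam1 K])
    have "k \<in> {lam<..K}" using k by simp
    then show "\<xi> \<in> Xeps lam K \<union> Y0 lam" unfolding Xeps_def using that by blast
  qed
  show "Psi \<xi> = (x (k - lam), 0)" if "\<xi> \<in> Xlev k"
    using eps Phi_clauses(2)[OF lam1 k(1) that] that by simp
  show "Psi \<xi> = (x (k - lam), l1 (x (k - lam)))" if "\<xi> \<in> cyl (k - 1) ptx \<inter> Y S1 k"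
    using eps Phi_clauses(3)[OF lam1 k(1) that] that by simp
  show "Psi \<xi> = (x (k - lam), - l1 (x (k - lam)))" if "\<xi> \<in> cyl (k - 1) pty \<inter> Y S2 k"
    using eps Phi_clauses(4)[OF lam1 k(1) that] that by simp
qed

lemma level_cases:
  assumes "\<xi> \<in> Y S1 k \<union> Y S2 k"
  obtains "\<xi> \<in> Xlev k" | "\<xi> \<in> cyl (k - 1) ptx \<inter> Y S1 k" | "\<xi> \<in> cyl (k - 1) pty \<inter> Y S2 k"
  using assms unfolding Xlev_def by blast

lemma fst_Psi_level:
  assumes "lam < k" "k \<le> K" "\<xi> \<in> Y S1 k \<union> Y S2 k"
  shows "fst (Psi \<xi>) = x (k - lam)"
  by (rule level_cases[OF assms(3)]) (simp_all add: Psi_level[OF assms(1,2)])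

lemma Psi_deep:
  assumes "\<xi> \<in> Ytilde S1 K \<union> Ytilde S2 K"
  shows "Psi \<xi> = (d, if \<xi> \<in> cyl K ptx then l1 d else if \<xi> \<in> cyl K pty then - l1 d else 0)"
proof -
  have lam1: "lam \<ge> 1" using lam by simp
  show ?thesis
    using Phi_eps_clauses(2-4)[OF lam1 K, of \<xi> a l1 x] assms by (auto simp: d_def)
qed

text \<open>Each case in the definition inspects at most the first \<open>K\<close> symbols. Hence
  the potential is a simple function for every invariant measure.\<close>

lemma Psi_local:
  assumes \<xi>: "\<xi> \<in> X" "\<zeta> \<in> X" "\<forall>i<K. \<xi> i = \<zeta> i"
  shows "Psi \<xi> = Psi \<zeta>"
proof -
  have Yt: "\<xi> \<in> Ytilde S k \<longleftrightarrow> \<zeta> \<in> Ytilde S k" if "k \<le> K" for S k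
    using \<xi> that by (auto simp: Ytilde_def)
  have cyl: "\<xi> \<in> cyl k z \<longleftrightarrow> \<zeta> \<in> cyl k z" if "k \<le> K" for z k
    using \<xi> that by (auto simp: cyl_def)
  have Y: "\<xi> \<in> Y S k \<longleftrightarrow> \<zeta> \<in> Y S k" if "k \<le> K" for S k
    using Yt[of k S] Yt[of "k - 1" S] that by (simp add: Y_def)
  from \<xi>(1) show ?thesis
  proof (cases rule: point_cases)
    case Y0
    then have "\<zeta> \<in> Y0 lam" using Yt[of lam] K \<xi> by (simp add: Y0_def)
    with Y0 show ?thesis by (simp add: Psi_Y0)
  next
    case (level k)
    have k: "k - 1 \<le> K" using level by simp
    have Xl: "\<xi> \<in> Xlev k \<longleftrightarrow> \<zeta> \<in> Xlev k"
      using Y[OF level(2)] cyl[OF k] by (simp add: Xlev_def)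
    show ?thesis
    proof (rule level_cases[OF level(3)])
      assume "\<xi> \<in> Xlev k"
      with Xl show ?thesis using Psi_level(1)[OF level(1,2)] by simp
    next
      assume *: "\<xi> \<in> cyl (k - 1) ptx \<inter> Y S1 k"
      then have "\<zeta> \<in> cyl (k - 1) ptx \<inter> Y S1 k" using Y[OF level(2)] cyl[OF k] by simp
      with * show ?thesis using Psi_level(2)[OF level(1,2)] by metis
    next
      assume *: "\<xi> \<in> cyl (k - 1) pty \<inter> Y S2 k"
      then have "\<zeta> \<in> cyl (k - 1) pty \<inter> Y S2 k" using Y[OF level(2)] cyl[OF k] by simp
      with * show ?thesis using Psi_level(3)[OF level(1,2)] by metis
    qed
  next
    case deep
    then have "\<zeta> \<in> Ytilde S1 K \<union> Ytilde S2 K" using Yt[of K] by simp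
    with deep show ?thesis using cyl[of K] by (simp add: Psi_deep)
  qed
qed

text \<open>A change at level \<open>k \<le> K\<close> gives the value x (k - lam), strictly above
  \<open>d\<close> because the sequence decreases and k - lam is below K + 1 - lam; on
  \<open>Y0 lam\<close> the value is \<open>a\<close>, again above \<open>d\<close>.\<close>

lemma fst_Psi_ge:
  assumes "\<xi> \<in> X"
  shows "d \<le> fst (Psi \<xi>)" "fst (Psi \<xi>) = d \<Longrightarrow> \<xi> \<in> Ytilde S1 K \<union> Ytilde S2 K"
proof -
  from assms have "d < fst (Psi \<xi>) \<or> fst (Psi \<xi>) = d \<and> \<xi> \<in> Ytilde S1 K \<union> Ytilde S2 K"
  proof (cases rule: point_cases)
    case (level k)
    then have "d < x (k - lam)" unfolding d_def by (intro x_strict_antimono) auto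
    then show ?thesis by (simp add: fst_Psi_level[OF level])
  qed (use d_range in \<open>auto simp: Psi_Y0 Psi_deep\<close>)
  then show "d \<le> fst (Psi \<xi>)" "fst (Psi \<xi>) = d \<Longrightarrow> \<xi> \<in> Ytilde S1 K \<union> Ytilde S2 K" by auto
qed

lemma simple_Psi:
  assumes "\<mu> \<in> invariant_measures"
  shows "simple_function \<mu> (\<lambda>\<xi>. fst (Psi \<xi>))" "simple_function \<mu> (\<lambda>\<xi>. snd (Psi \<xi>))"
proof -
  interpret invariant_measure \<mu> by unfold_locales (rule assms)
  have Psi: "simple_function \<mu> Psi" by (rule simple_function_local[OF Psi_local])
  show "simple_function \<mu> (\<lambda>\<xi>. fst (Psi \<xi>))" by (rule simple_function_compose1[OF Psi])
  show "simple_function \<mu> (\<lambda>\<xi>. snd (Psi \<xi>))" by (rule simple_function_compose1[OF Psi])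
qed

text \<open>Measurability depends on the sigma-algebra only, so any one invariant measure can supply
  it; the point mass is at hand.\<close>

lemma measurable_Psi:
  "(\<lambda>\<xi>. fst (Psi \<xi>)) \<in> borel_measurable borel_X" "(\<lambda>\<xi>. snd (Psi \<xi>)) \<in> borel_measurable borel_X"
  using simple_Psi[OF dirac_invariant, THEN borel_measurable_simple_function]
  by (simp_all cong: measurable_cong_sets)

section \<open>Lower limit: the extreme rotation vector\<close>

text \<open>A function whose mean is its extreme value is constant almost everywhere. The first
  coordinate at its minimum confines the measure to points without class change in the first
  \<open>K\<close> symbols; there the second coordinate at its maximum forces these symbols to be
  1.\<close>

lemma ks_entropy_eq_0_if_rv_extreme:
  assumes \<mu>: "\<mu> \<in> invariant_measures" and rv: "rv Psi \<mu> = (d, l1 d)"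
  shows "ks_entropy \<mu> shift = 0"
proof -
  interpret invariant_measure \<mu> by unfold_locales (rule \<mu>)
  note int = simple_Psi[OF \<mu>, THEN integrable_simple]
  have "integrable \<mu> (\<lambda>\<xi>. fst (Psi \<xi>) - d)" "(\<integral>\<xi>. fst (Psi \<xi>) - d \<partial>\<mu>) = 0"
    using int rv by (simp_all add: rv_def prob_space)
  moreover have "AE \<xi> in \<mu>. 0 \<le> fst (Psi \<xi>) - d"
    using fst_Psi_ge(1) by (intro AE_I2) simp
  ultimately have "AE \<xi> in \<mu>. fst (Psi \<xi>) - d = 0"
    using integral_nonneg_eq_0_iff_AE by blast
  then have deep: "AE \<xi> in \<mu>. \<xi> \<in> Ytilde S1 K \<union> Ytilde S2 K"
    using AE_space by eventually_elim (auto dest: fst_Psi_ge(2))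
  \<comment> \<open>Strict positivity separates \<open>l1 d\<close> from the other two values 0 and
    \<open>- l1 d\<close>.\<close>
  have l1d: "l1 d > 0" by (rule l1_pos[OF d_range])
  have "integrable \<mu> (\<lambda>\<xi>. l1 d - snd (Psi \<xi>))" "(\<integral>\<xi>. l1 d - snd (Psi \<xi>) \<partial>\<mu>) = 0"
    using int rv by (simp_all add: rv_def prob_space)
  moreover have "AE \<xi> in \<mu>. 0 \<le> l1 d - snd (Psi \<xi>)"
    using deep by eventually_elim (use l1d in \<open>simp add: Psi_deep\<close>)
  ultimately have "AE \<xi> in \<mu>. l1 d - snd (Psi \<xi>) = 0"
    using integral_nonneg_eq_0_iff_AE by blast
  with deep have "AE \<xi> in \<mu>. \<xi> 0 = 1"
  proof eventually_elim
    case (elim \<xi>)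
    then have "\<xi> \<in> cyl K ptx" using l1d by (auto simp: Psi_deep split: if_splits)
    then show ?case using lam K by (simp add: cyl_def ptx_def)
  qed
  then show ?thesis by (rule ks_entropy_eq_0_if_AE_first)
qed

lemma rv_dirac: "rv Psi (return borel_X ptx) = (d, l1 d)"
proof -
  have X: "ptx \<in> X" by (simp add: X_def ptx_def)
  then have "ptx \<in> cyl K ptx" "ptx \<in> Ytilde S1 K" by (auto simp: cyl_def Ytilde_def S1_def ptx_def)
  then show ?thesis using X by (simp add: rv_def integral_return measurable_Psi Psi_deep)
qed

text \<open>Membership in \<open>Rot\<close> makes the supremum range over a nonempty set; over the
  empty set it would be minus infinity.\<close>

lemma loc_entropy_nonneg:
  assumes "w \<in> Rot Psi"
  shows "0 \<le> loc_entropy Psi w"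
proof -
  obtain \<mu> where \<mu>: "\<mu> \<in> invariant_measures" "rv Psi \<mu> = w" using assms by (auto simp: Rot_def)
  interpret invariant_measure \<mu> by unfold_locales (rule \<mu>)
  have "ks_entropy \<mu> shift \<le> loc_entropy Psi w"
    unfolding loc_entropy_def using \<mu> by (intro SUP_upper) simp
  with ks_entropy_nonneg show ?thesis by (rule order_trans)
qed

lemma extreme_in_Rot: "(d, l1 d) \<in> Rot Psi"
  unfolding Rot_def using dirac_invariant rv_dirac by (metis imageI)

lemma dist_origin: "dist (0, 0) w = norm w" for w :: "real \<times> real"
  by (simp add: zero_prod_def[symmetric])

lemma h_lower_eq_0:
  assumes r: "norm (d, l1 d) \<le> r"
  shows "h_lower Psi (0, 0) r = 0"
proof -
  let ?w = "(d, l1 d)"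
  have w: "?w \<in> cball (0, 0) r \<inter> Rot Psi" using r extreme_in_Rot by (simp add: dist_origin)
  have "loc_entropy Psi ?w \<le> 0"
    unfolding loc_entropy_def by (rule SUP_least) (simp add: ks_entropy_eq_0_if_rv_extreme)
  then have "(INF w\<in>cball (0, 0) r \<inter> Rot Psi. loc_entropy Psi w) \<le> 0"
    using w by (meson INF_lower order_trans)
  moreover have "0 \<le> (INF w\<in>cball (0, 0) r \<inter> Rot Psi. loc_entropy Psi w)"
    by (rule INF_greatest) (simp add: loc_entropy_nonneg)
  ultimately show ?thesis using w by (auto simp: h_lower_def)
qed

section \<open>Upper limit: attaining and bounding log 2\<close>

lemma coin_code_deep: "coin_code \<omega> \<in> Ytilde S1 K"
  using coin_code_X coin_code_01 by (auto simp: Ytilde_def S1_def)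

text \<open>Coin sequences never show the symbol 3, so the negative value is not taken: the first
  coordinate is constantly \<open>d\<close> and the second lies between 0 and \<open>l1 d\<close>.
  This puts the rotation vector of \<open>coin\<close> into the ball.\<close>

lemma norm_rv_coin_le: "norm (rv Psi coin) \<le> norm (d, l1 d)"
proof -
  have l1d: "l1 d > 0" by (rule l1_pos[OF d_range])
  have "K > 0" using lam K by simp
  then have "coin_code \<omega> 0 = 3" if "coin_code \<omega> \<in> cyl K pty" for \<omega>
    using that by (simp add: cyl_def pty_def)
  then have "coin_code \<omega> \<notin> cyl K pty" for \<omega>
    using coin_code_01[of \<omega> 0] by fastforce
  then have Psi: "Psi (coin_code \<omega>) = (d, if coin_code \<omega> \<in> cyl K ptx then l1 d else 0)" for \<omega>
    using coin_code_deep by (simp add: Psi_deep)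
  have "(\<integral>\<xi>. fst (Psi \<xi>) \<partial>coin) = d"
    unfolding coin_def by (simp add: integral_distr[OF measurable_coin_code measurable_Psi(1)] Psi)
  moreover have "integrable coin_base (\<lambda>\<omega>. snd (Psi (coin_code \<omega>)))"
    using simple_Psi(2)[OF coin_invariant, THEN coin.integrable_simple]
    by (simp add: coin_def integrable_distr_eq[OF measurable_coin_code measurable_Psi(2)])
  then have "0 \<le> (\<integral>\<xi>. snd (Psi \<xi>) \<partial>coin) \<and> (\<integral>\<xi>. snd (Psi \<xi>) \<partial>coin) \<le> l1 d"
    unfolding coin_def integral_distr[OF measurable_coin_code measurable_Psi(2)] using l1d
    by (intro conjI coin_prob.integral_ge_const coin_prob.integral_le_const AE_I2) (auto simp: Psi)
  ultimately show ?thesis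
    unfolding rv_def norm_Pair by (simp add: power_mono)
qed

lemma h_upper_ge:
  assumes r: "norm (d, l1 d) \<le> r"
  shows "ereal (ln 2) \<le> h_upper Psi (0, 0) r"
proof -
  let ?w = "rv Psi coin"
  have w: "?w \<in> cball (0, 0) r \<inter> Rot Psi"
    using r norm_rv_coin_le coin_invariant by (simp add: dist_origin Rot_def)
  have "ereal (ln 2) \<le> ks_entropy coin shift" by (rule ks_entropy_coin)
  also have "\<dots> \<le> loc_entropy Psi ?w"
    unfolding loc_entropy_def using coin_invariant by (intro SUP_upper) simp
  also have "\<dots> \<le> (SUP w\<in>cball (0, 0) r \<inter> Rot Psi. loc_entropy Psi w)"
    using w by (rule SUP_upper)
  finally show ?thesis using w by (auto simp: h_upper_def)
qed

text \<open>The extra information \<open>R\<close> is the parity of the next symbol, at most ln 2,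
  together with the indicator of a class change, whose probability is at most r / a.\<close>

lemma ks_entropy_le_if_norm_rv_le:
  assumes \<mu>: "\<mu> \<in> invariant_measures" and r: "norm (rv Psi \<mu>) \<le> r"
  shows "ks_entropy \<mu> shift \<le> ereal (ln 2 + (2 * sqrt (r / a) + r / a))"
proof -
  interpret invariant_measure \<mu> by unfold_locales (rule \<mu>)
  note int = simple_Psi(1)[OF \<mu>, THEN integrable_simple]
  let ?change = "\<lambda>\<xi> :: nat \<Rightarrow> nat. (\<xi> 0 \<in> S1) \<noteq> (\<xi> 1 \<in> S1)"
  define B where "B = {\<xi>\<in>X. ?change \<xi>}"
  have change: "simple_function \<mu> ?change" by (rule simple_function_local[of 2]) auto
  have parity: "simple_function \<mu> (\<lambda>\<xi>. \<xi> 1 mod 2)" by (rule simple_function_local[of 2]) auto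
  have B: "B \<in> events"
    using simple_functionD(2)[OF change, of "{True}"] by (simp add: B_def vimage_def Int_def conj_commute)
  have B_X: "B \<inter> X = B" by (auto simp: B_def)
  have "B \<subseteq> Y0 lam"
  proof
    fix \<xi> assume \<xi>: "\<xi> \<in> B"
    have lam01: "0 < lam" "1 < lam" using lam by simp_all
    have "\<xi> \<notin> Ytilde S1 lam"
      using \<xi> lam01 unfolding B_def Ytilde_def by blast
    moreover have "\<xi> \<notin> Ytilde S2 lam"
    proof
      assume "\<xi> \<in> Ytilde S2 lam"
      then have "\<xi> 0 \<in> S2" "\<xi> 1 \<in> S2" using lam01 unfolding Ytilde_def by blast+
      then show False using \<xi> by (auto simp: B_def S1_def S2_def)
    qed
    ultimately show "\<xi> \<in> Y0 lam" using \<xi> by (simp add: B_def Y0_def)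
  qed
  \<comment> \<open>Markov's inequality in pointwise form: the first coordinate is \<open>a\<close>
    on \<open>Y0 lam\<close> and positive elsewhere.\<close>
  then have le: "a * indicator B \<xi> \<le> fst (Psi \<xi>)" if "\<xi> \<in> X" for \<xi>
    using fst_Psi_ge(1)[OF that] d_range Psi_Y0[of \<xi>] by (auto simp: indicator_def)
  have "a * prob B = (\<integral>\<xi>. a * indicator B \<xi> \<partial>\<mu>)"
    using B B_X by simp
  also have "\<dots> \<le> (\<integral>\<xi>. fst (Psi \<xi>) \<partial>\<mu>)"
    using B le by (intro integral_mono int) (auto simp: emeasure_eq_measure)
  also have "\<dots> \<le> norm (rv Psi \<mu>)"
    using norm_fst_le[of "fst (rv Psi \<mu>)" "snd (rv Psi \<mu>)"] by (simp add: rv_def)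
  finally have "prob B \<le> r / a" using r a_pos by (simp add: field_simps)
  then have "ent \<mu> (\<lambda>\<xi>. \<xi> \<in> B) \<le> 2 * sqrt (r / a) + r / a" by (rule ent_indicator_le[OF B])
  moreover have "ent \<mu> (\<lambda>\<xi>. \<xi> \<in> B) = ent \<mu> ?change"
    by (rule ent_cong) (simp add: B_def)
  moreover have "ent \<mu> (\<lambda>\<xi>. \<xi> 1 mod 2) \<le> ln (real (card {0, 1 :: nat}))"
    by (rule ent_le_ln_card[OF parity]) auto
  ultimately have "ent \<mu> (\<lambda>\<xi>. (\<xi> 1 mod 2, ?change \<xi>)) \<le> ln 2 + (2 * sqrt (r / a) + r / a)"
    using ent_pair_le[OF parity change] by simp
  then show ?thesis
  proof (rule ks_entropy_shift_le[OF simple_function_Pair[OF parity change]])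
    \<comment> \<open>The present symbol and the change indicator give the class of the next symbol;
      its parity then selects one of the two members of that class.\<close>
    fix \<xi> \<zeta>
    assume \<xi>: "\<xi> \<in> X" "\<zeta> \<in> X" "\<xi> 0 = \<zeta> 0" "(\<xi> 1 mod 2, ?change \<xi>) = (\<zeta> 1 mod 2, ?change \<zeta>)"
    have "\<xi> 1 \<in> {0, 1, 2, 3}" "\<zeta> 1 \<in> {0, 1, 2, 3}" using \<xi> by (auto simp: X_def)
    moreover have "\<xi> 1 mod 2 = \<zeta> 1 mod 2" "\<xi> 1 \<in> S1 \<longleftrightarrow> \<zeta> 1 \<in> S1" using \<xi> by auto
    ultimately show "\<xi> 1 = \<zeta> 1" by (auto simp: S1_def)
  qed
qed

lemma h_upper_le:
  assumes r: "norm (d, l1 d) \<le> r"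
  shows "h_upper Psi (0, 0) r \<le> ereal (ln 2 + (2 * sqrt (r / a) + r / a))"
proof -
  have "loc_entropy Psi w \<le> ereal (ln 2 + (2 * sqrt (r / a) + r / a))" if "norm w \<le> r" for w
    unfolding loc_entropy_def using that by (intro SUP_least ks_entropy_le_if_norm_rv_le) auto
  then have "(SUP w\<in>cball (0, 0) r \<inter> Rot Psi. loc_entropy Psi w)
      \<le> ereal (ln 2 + (2 * sqrt (r / a) + r / a))"
    by (intro SUP_least) (simp add: dist_origin)
  \<comment> \<open>A point in the intersection rules out the convention that gives infinity on the
    empty set.\<close>
  moreover have "(d, l1 d) \<in> cball (0, 0) r \<inter> Rot Psi"
    using r extreme_in_Rot by (simp add: dist_origin)
  ultimately show ?thesis by (auto simp: h_upper_def)
qed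

end

section \<open>Passage to the limit\<close>

theorem theorem7p3:
  fixes a :: real and l1 :: "real \<Rightarrow> real" and x :: "nat \<Rightarrow> real"
    and lam :: nat and K :: "nat \<Rightarrow> nat"
  assumes "a > 0"
    and "continuous_on {0..a} l1"
    and "\<And>t. t \<in> {0..a} \<Longrightarrow> l1 t \<ge> 0"
    and "mono_on {0..a} l1"
    and "\<And>s t u. s \<in> {0..a} \<Longrightarrow> t \<in> {0..a} \<Longrightarrow> s \<noteq> t \<Longrightarrow> 0 < u \<Longrightarrow> u < 1 \<Longrightarrow>
           l1 ((1 - u) * s + u * t) > (1 - u) * l1 s + u * l1 t"
    and "l1 0 = 0"
    and "\<And>k. k \<ge> 1 \<Longrightarrow> x k \<in> {0<..<a}"
    and "\<And>k. k \<ge> 1 \<Longrightarrow> x (Suc k) < x k"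
    and "\<exists>C \<theta>. 0 < \<theta> \<and> \<theta> < 1 \<and> (\<forall>k\<ge>1. x k \<le> C * \<theta> ^ k)"
    and "lam \<ge> 3"
    and "(\<Sum>k. x (Suc k)) < a"
    and "l1 (x 1) < (real lam + 1) * l1 (x 2)"
    and "\<And>n. n \<ge> 1 \<Longrightarrow> K n \<ge> 2 * lam"
    and "\<And>n k l. n \<ge> 1 \<Longrightarrow> k \<ge> K n \<Longrightarrow> l \<ge> K n \<Longrightarrow>
           norm (x (k - lam), l1 (x (k - lam))) < (1 / 2) ^ n \<and>
           norm ((x (k - lam), l1 (x (k - lam))) - (x (l - lam), l1 (x (l - lam)))) < (1 / 2) ^ n"
  shows "(\<lambda>n. h_lower (Phi_eps a l1 x lam (K n)) (0, 0) ((1 / 2) ^ n)) \<longlonglongrightarrow> 0 \<and>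
         (\<lambda>n. h_upper (Phi_eps a l1 x lam (K n)) (0, 0) ((1 / 2) ^ n)) \<longlonglongrightarrow> ereal (ln 2) \<and>
         lim (\<lambda>n. h_lower (Phi_eps a l1 x lam (K n)) (0, 0) ((1 / 2) ^ n))
           < lim (\<lambda>n. h_upper (Phi_eps a l1 x lam (K n)) (0, 0) ((1 / 2) ^ n))"
proof -
  let ?P = "\<lambda>n. Phi_eps a l1 x lam (K n)"
  have l1_pos: "l1 t > 0" if t: "t \<in> {0<..<a}" for t
  proof -
    \<comment> \<open>Strict concavity on the chord from 0 to \<open>a\<close> with weight t / a;
      the chord is nonnegative because \<open>l1 0 = 0\<close> and
      \<open>l1 a \<ge> 0\<close>.\<close>
    have "l1 ((1 - t / a) * 0 + t / a * a) > (1 - t / a) * l1 0 + t / a * l1 a"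
      using t by (intro assms(5)) auto
    moreover have "t / a * l1 a \<ge> 0" using t assms(3)[of a] by simp
    ultimately show ?thesis using t assms(6) by simp
  qed
  have approx: "approximation a l1 x lam (K n)" if "n \<ge> 1" for n
  proof
    show "x k \<in> {0<..<a}" "x (Suc k) < x k" if "k \<ge> 1" for k
      using that by (rule assms(7), rule assms(8))
    show "2 \<le> lam" "lam \<le> K n" using assms(10) assms(13)[OF that] by simp_all
  qed (rule l1_pos)
  \<comment> \<open>Index \<open>K n + 1\<close> is the one that occurs in \<open>d\<close>, so the
    choice of \<open>K n\<close> bounds the extreme vector by the radius.\<close>
  have norm: "norm (approximation.d x lam (K n), l1 (approximation.d x lam (K n))) \<le> (1 / 2) ^ n"
    if "n \<ge> 1" for n
    using assms(14)[OF that, of "K n + 1" "K n + 1"]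
    unfolding approximation.d_def[OF approx[OF that]] by simp
  have low: "h_lower (?P n) (0, 0) ((1 / 2) ^ n) = 0" if "n \<ge> 1" for n
    by (rule approximation.h_lower_eq_0[OF approx[OF that] norm[OF that]])
  have ge: "ereal (ln 2) \<le> h_upper (?P n) (0, 0) ((1 / 2) ^ n)" if "n \<ge> 1" for n
    by (rule approximation.h_upper_ge[OF approx[OF that] norm[OF that]])
  have le: "h_upper (?P n) (0, 0) ((1 / 2) ^ n)
      \<le> ereal (ln 2 + (2 * sqrt ((1 / 2) ^ n / a) + (1 / 2) ^ n / a))" if "n \<ge> 1" for n
    by (rule approximation.h_upper_le[OF approx[OF that] norm[OF that]])
  \<comment> \<open>The assumptions on \<open>K\<close> start at \<open>n = 1\<close>, hence the
    eventual form.\<close>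
  have lower: "(\<lambda>n. h_lower (?P n) (0, 0) ((1 / 2) ^ n)) \<longlonglongrightarrow> 0"
    by (rule tendsto_eventually, rule eventually_sequentiallyI[of 1]) (rule low)
  have lim0: "(\<lambda>n. (1 / 2) ^ n / a) \<longlonglongrightarrow> 0 / a"
    using assms(1) by (intro tendsto_divide tendsto_const LIMSEQ_realpow_zero) auto
  have "(\<lambda>n. ln 2 + (2 * sqrt ((1 / 2) ^ n / a) + (1 / 2) ^ n / a))
      \<longlonglongrightarrow> ln 2 + (2 * sqrt (0 / a) + 0 / a)"
    by (intro tendsto_add tendsto_mult tendsto_const tendsto_real_sqrt lim0)
  then have lim: "(\<lambda>n. ereal (ln 2 + (2 * sqrt ((1 / 2) ^ n / a) + (1 / 2) ^ n / a))) \<longlonglongrightarrow> ereal (ln 2)"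
    by simp
  have ev_ge: "\<forall>\<^sub>F n in sequentially. ereal (ln 2) \<le> h_upper (?P n) (0, 0) ((1 / 2) ^ n)"
    by (rule eventually_sequentiallyI[of 1]) (rule ge)
  have ev_le: "\<forall>\<^sub>F n in sequentially. h_upper (?P n) (0, 0) ((1 / 2) ^ n)
      \<le> ereal (ln 2 + (2 * sqrt ((1 / 2) ^ n / a) + (1 / 2) ^ n / a))"
    by (rule eventually_sequentiallyI[of 1]) (rule le)
  have upper: "(\<lambda>n. h_upper (?P n) (0, 0) ((1 / 2) ^ n)) \<longlonglongrightarrow> ereal (ln 2)"
    by (rule tendsto_sandwich[OF ev_ge ev_le tendsto_const lim])
  show ?thesis
    using lower upper limI[OF lower] limI[OF upper] by simp
qed

end
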